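(* Let $\Pi$ be a simple root system compatible with $C$. Then the function $h^\Pi\colon I\to\mathbb Z_{2h}$ defined by $\Phi(\beta_i^\Pi)=(i,h^\Pi(i))$ is a height function. Conversely, every height function can be obtained in this way from a unique simple root system compatible with $C$.
   Context: $R\subset E$ is a reduced, irreducible, simply-laced root system (type $A,D,E$) of rank $r$ in a Euclidean space $E$ with $W$-invariant inner product $(\cdot,\cdot)$ normalized so that $(\alpha,\alpha)=2$ for $\alpha\in R$; $W$ is its Weyl group. A simple root system $\Pi\subset R$ is a base of $R$. There is a fixed index set $I$ and, for each simple root system $\Pi$, a bijection $I\to\Pi$, $i\mapsto\alpha_i^\Pi$, such that $w(\alpha_i^\Pi)=\alpha_i^{w(\Pi)}$ for all $w\in W$. For $i\ne j$ put $n_{ij}=-(\alpha_i^\Pi,\alpha_j^\Pi)\in\{0,1\}$ (independent of $\Pi$); $I$ also denotes the Dynkin diagram, the graph with vertex set $I$ and $n_{ij}$ edges between $i$ and $j$. Let $s_i^\Pi$ be the reflection in $\alpha_i^\Pi$. A Coxeter element is a product, in some order, of all the simple reflections of some simple root system, each taken once. A Coxeter element $C$ is fixed; $h$ is its order (Coxeter number). $\Pi$ is compatible with $C$ if $C=s^\Pi_{i_1}\cdots s^\Pi_{i_r}$ for some enumeration $i_1,\dots,i_r$ of $I$. For compatible $\Pi$, the orientation $\Omega_\Pi$ of $I$ is: for $n_{ij}=1$, $i\to j$ if $s_i^\Pi$ precedes $s_j^\Pi$ in such an expression for $C$ (independent of the expression). Write $i\leqslant j$ if there is an oriented path (possibly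 of length $0$) from $i$ to $j$ in $\Omega_\Pi$, and set $\beta_i^\Pi=\sum_{j\leqslant i}\alpha_j^\Pi$. The $C$-orbit of $\beta_i^\Pi$ does not depend on the choice of $\Pi$ compatible with $C$. Fix $p\colon I\to\mathbb Z_2$ with $p(i)=p(j)+1$ whenever $i,j$ are connected by an edge, and let $\widehat I=\{(i,n)\in I\times\mathbb Z_{2h}\mid p(i)+n\equiv 0 \bmod 2\}$, with $\tau(i,n)=(i,n+2)$. Fix $i_0\in I$ and a bijection $\Phi_0$ from the $C$-orbit of $\beta_{i_0}^\Pi$ onto $\{(i_0,n)\in\widehat I\}$ with $\Phi_0(C\beta)=\tau\Phi_0(\beta)$ (independent of $\Pi$). $\Phi\colon R\to\widehat I$ is the unique bijection such that, for any $\Pi$ compatible with $C$: $\Phi(C\beta)=\tau\Phi(\beta)$ for all $\beta\in R$; $\Phi(\beta_i^\Pi)\in\{i\}\times\mathbb Z_{2h}$ for all $i\in I$; if $i\to j$ in $\Omega_\Pi$ and $\Phi(\beta_i^\Pi)=(i,n)$ then $\Phi(\beta_j^\Pi)=(j,n+1)$; and $\Phi=\Phi_0$ on the $C$-orbit of $\beta_{i_0}^\Pi$. ($\Phi$ exists and does not depend on $\Pi$.) A height function is a function $\eta\colon I\to\mathbb Z_{2h}$ such that $\eta(j)=\eta(i)\pm1$ whenever $i,j$ are connected by an edge in $I$, and $\eta(i)\equiv p(i)\bmod 2$ for all $i$. *)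

theory Defs
  imports "HOL-Analysis.Analysis" "HOL-Library.Z2"
begin

section \<open>Root systems\<close>

definition root_reflection :: "'a::real_inner \<Rightarrow> 'a \<Rightarrow> 'a" where
  "root_reflection a x = x - (2 * (x \<bullet> a) / (a \<bullet> a)) *\<^sub>R a"

definition root_system :: "'a::euclidean_space set \<Rightarrow> bool" where
  "root_system R \<longleftrightarrow> finite R \<and> 0 \<notin> R \<and> span R = UNIV \<and>
     (\<forall>a\<in>R. root_reflection a ` R = R) \<and>
     (\<forall>a\<in>R. \<forall>b\<in>R. 2 * (b \<bullet> a) / (a \<bullet> a) \<in> \<int>)"

definition reduced_system :: "'a::euclidean_space set \<Rightarrow> bool" where
  "reduced_system R \<longleftrightarrow> (\<forall>a\<in>R. \<forall>c::real. c *\<^sub>R a \<in> R \<longrightarrow> c = 1 \<or> c = -1)"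

definition irreducible_system :: "'a::euclidean_space set \<Rightarrow> bool" where
  "irreducible_system R \<longleftrightarrow> R \<noteq> {} \<and>
     \<not> (\<exists>A B. A \<noteq> {} \<and> B \<noteq> {} \<and> A \<union> B = R \<and> (\<forall>a\<in>A. \<forall>b\<in>B. a \<bullet> b = 0))"

text \<open>All roots have the same length, normalized so that the square length is 2. The inner
  product of the ambient type is invariant under the reflections by construction.\<close>

definition simply_laced_normalized :: "'a::euclidean_space set \<Rightarrow> bool" where
  "simply_laced_normalized R \<longleftrightarrow> (\<forall>a\<in>R. a \<bullet> a = 2)"

inductive_set weyl_group :: "'a::euclidean_space set \<Rightarrow> ('a \<Rightarrow> 'a) set" for R where
  weyl_id: "id \<in> weyl_group R"
| weyl_step: "a \<in> R \<Longrightarrow> w \<in> weyl_group R \<Longrightarrow> root_reflection a \<circ> w \<in> weyl_group R"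

text \<open>A simple system is written \<open>\<Delta>\<close>, since \<open>\<Pi>\<close> is the binder for dependent function sets.\<close>

definition simple_system :: "'a::euclidean_space set \<Rightarrow> 'a set \<Rightarrow> bool" where
  "simple_system R \<Delta> \<longleftrightarrow> \<Delta> \<subseteq> R \<and> independent \<Delta> \<and>
     (\<forall>b\<in>R. \<exists>c::'a \<Rightarrow> int. b = (\<Sum>a\<in>\<Delta>. of_int (c a) *\<^sub>R a) \<and>
        ((\<forall>a\<in>\<Delta>. c a \<ge> 0) \<or> (\<forall>a\<in>\<Delta>. c a \<le> 0)))"

section \<open>Indexing of simple roots and the Dynkin diagram\<close>

text \<open>The index set \<open>I\<close> is the (arbitrary) type \<open>'i\<close>; \<open>\<alpha> \<Delta> i\<close> is the simple root of \<open>\<Delta>\<close> with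
  index \<open>i\<close>. The values of \<open>\<alpha>\<close> at sets that are not simple systems are irrelevant.\<close>

definition simple_root_indexing ::
    "'a::euclidean_space set \<Rightarrow> ('a set \<Rightarrow> 'i \<Rightarrow> 'a) \<Rightarrow> bool" where
  "simple_root_indexing R \<alpha> \<longleftrightarrow>
     (\<forall>\<Delta>. simple_system R \<Delta> \<longrightarrow> bij_betw (\<alpha> \<Delta>) UNIV \<Delta> \<and>
        (\<forall>w\<in>weyl_group R. \<forall>i. w (\<alpha> \<Delta> i) = \<alpha> (w ` \<Delta>) i))"

text \<open>The number \<open>- (\<alpha> \<Delta> i \<bullet> \<alpha> \<Delta> j)\<close> of edges between \<open>i\<close> and \<open>j\<close> does not depend on \<open>\<Delta>\<close>, so any
  simple system may be used to compute it.\<close>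

definition adjacent ::
    "'a::euclidean_space set \<Rightarrow> ('a set \<Rightarrow> 'i \<Rightarrow> 'a) \<Rightarrow> 'i \<Rightarrow> 'i \<Rightarrow> bool" where
  "adjacent R \<alpha> i j \<longleftrightarrow> i \<noteq> j \<and> (\<exists>\<Delta>. simple_system R \<Delta> \<and> - (\<alpha> \<Delta> i \<bullet> \<alpha> \<Delta> j) = 1)"

section \<open>Coxeter elements and compatible simple systems\<close>

text \<open>The leftmost factor of the product is the head of the list and is applied last.\<close>

definition reflection_product :: "'a::real_inner list \<Rightarrow> 'a \<Rightarrow> 'a" where
  "reflection_product as = foldr (\<circ>) (map root_reflection as) id"

definition coxeter_element :: "'a::euclidean_space set \<Rightarrow> ('a \<Rightarrow> 'a) \<Rightarrow> bool" where
  "coxeter_element R C \<longleftrightarrow>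
     (\<exists>\<Delta> as. simple_system R \<Delta> \<and> distinct as \<and> set as = \<Delta> \<and> C = reflection_product as)"

definition coxeter_number :: "('a \<Rightarrow> 'a) \<Rightarrow> nat" where
  "coxeter_number C = (LEAST n. 0 < n \<and> C ^^ n = id)"

definition coxeter_expression ::
    "('a::euclidean_space set \<Rightarrow> 'i \<Rightarrow> 'a) \<Rightarrow> ('a \<Rightarrow> 'a) \<Rightarrow> 'a set \<Rightarrow> 'i list \<Rightarrow> bool" where
  "coxeter_expression \<alpha> C \<Delta> js \<longleftrightarrow>
     distinct js \<and> set js = UNIV \<and> C = reflection_product (map (\<alpha> \<Delta>) js)"

definition compatible ::
    "'a::euclidean_space set \<Rightarrow> ('a set \<Rightarrow> 'i \<Rightarrow> 'a) \<Rightarrow> ('a \<Rightarrow> 'a) \<Rightarrow> 'a set \<Rightarrow> bool" where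
  "compatible R \<alpha> C \<Delta> \<longleftrightarrow> simple_system R \<Delta> \<and> (\<exists>js. coxeter_expression \<alpha> C \<Delta> js)"

text \<open>The orientation \<open>\<Omega>\<^sub>\<Delta>\<close>: the relative order of two adjacent indices is the same in all
  expressions of \<open>C\<close> as a product of the simple reflections of \<open>\<Delta>\<close>.\<close>

definition arrow ::
    "'a::euclidean_space set \<Rightarrow> ('a set \<Rightarrow> 'i \<Rightarrow> 'a) \<Rightarrow> ('a \<Rightarrow> 'a) \<Rightarrow> 'a set \<Rightarrow> 'i \<Rightarrow> 'i \<Rightarrow> bool" where
  "arrow R \<alpha> C \<Delta> i j \<longleftrightarrow> adjacent R \<alpha> i j \<and>
     (\<exists>js. coxeter_expression \<alpha> C \<Delta> js \<and>
        (\<exists>k l. k < l \<and> l < length js \<and> js ! k = i \<and> js ! l = j))"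

definition beta ::
    "'a::euclidean_space set \<Rightarrow> ('a set \<Rightarrow> 'i \<Rightarrow> 'a) \<Rightarrow> ('a \<Rightarrow> 'a) \<Rightarrow> 'a set \<Rightarrow> 'i \<Rightarrow> 'a" where
  "beta R \<alpha> C \<Delta> i = (\<Sum>j | (arrow R \<alpha> C \<Delta>)\<^sup>*\<^sup>* j i. \<alpha> \<Delta> j)"

text \<open>Since a Coxeter element has finite order, nonnegative powers give the whole orbit.\<close>

definition orbit_of :: "('a \<Rightarrow> 'a) \<Rightarrow> 'a \<Rightarrow> 'a set" where
  "orbit_of C b = range (\<lambda>k::nat. (C ^^ k) b)"

section \<open>The quiver vertices and the map \<open>\<Phi>\<close>\<close>

text \<open>\<open>\<int>\<^sub>2\<^sub>h\<close> is represented by the integers in \<open>{0..<2 * h}\<close> with arithmetic modulo \<open>2 * h\<close>;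
  \<open>\<int>\<^sub>2\<close> is the type \<open>bit\<close>, so \<open>of_int n :: bit\<close> is the parity of \<open>n\<close>.\<close>

definition Z2h :: "nat \<Rightarrow> int set" where
  "Z2h h = {0..<2 * int h}"

definition parity_function ::
    "'a::euclidean_space set \<Rightarrow> ('a set \<Rightarrow> 'i \<Rightarrow> 'a) \<Rightarrow> ('i \<Rightarrow> bit) \<Rightarrow> bool" where
  "parity_function R \<alpha> p \<longleftrightarrow> (\<forall>i j. adjacent R \<alpha> i j \<longrightarrow> p i = p j + 1)"

definition Ihat :: "('i \<Rightarrow> bit) \<Rightarrow> nat \<Rightarrow> ('i \<times> int) set" where
  "Ihat p h = {(i, n). n \<in> Z2h h \<and> p i + of_int n = 0}"

definition tau :: "nat \<Rightarrow> 'i \<times> int \<Rightarrow> 'i \<times> int" where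
  "tau h = (\<lambda>(i, n). (i, (n + 2) mod (2 * int h)))"

text \<open>The normalization \<open>\<Phi>\<^sub>0\<close> on the orbit of \<open>\<beta>\<close> at \<open>i\<^sub>0\<close>, an orbit that is the same for all
  compatible \<open>\<Delta>\<close>; the values of \<open>\<Phi>\<^sub>0\<close> elsewhere are irrelevant.\<close>

definition is_Phi0 ::
    "'a::euclidean_space set \<Rightarrow> ('a set \<Rightarrow> 'i \<Rightarrow> 'a) \<Rightarrow> ('a \<Rightarrow> 'a) \<Rightarrow> ('i \<Rightarrow> bit) \<Rightarrow> 'i
      \<Rightarrow> ('a \<Rightarrow> 'i \<times> int) \<Rightarrow> bool" where
  "is_Phi0 R \<alpha> C p i0 \<Phi>0 \<longleftrightarrow>
     (\<forall>\<Delta>. compatible R \<alpha> C \<Delta> \<longrightarrow>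
        bij_betw \<Phi>0 (orbit_of C (beta R \<alpha> C \<Delta> i0)) {v \<in> Ihat p (coxeter_number C). fst v = i0} \<and>
        (\<forall>b\<in>orbit_of C (beta R \<alpha> C \<Delta> i0). \<Phi>0 (C b) = tau (coxeter_number C) (\<Phi>0 b)))"

definition is_Phi ::
    "'a::euclidean_space set \<Rightarrow> ('a set \<Rightarrow> 'i \<Rightarrow> 'a) \<Rightarrow> ('a \<Rightarrow> 'a) \<Rightarrow> ('i \<Rightarrow> bit) \<Rightarrow> 'i
      \<Rightarrow> ('a \<Rightarrow> 'i \<times> int) \<Rightarrow> ('a \<Rightarrow> 'i \<times> int) \<Rightarrow> bool" where
  "is_Phi R \<alpha> C p i0 \<Phi>0 \<Phi> \<longleftrightarrow>
     bij_betw \<Phi> R (Ihat p (coxeter_number C)) \<and>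
     (\<forall>\<Delta>. compatible R \<alpha> C \<Delta> \<longrightarrow>
        (\<forall>b\<in>R. \<Phi> (C b) = tau (coxeter_number C) (\<Phi> b)) \<and>
        (\<forall>i. \<Phi> (beta R \<alpha> C \<Delta> i) \<in> {i} \<times> Z2h (coxeter_number C)) \<and>
        (\<forall>i j n. arrow R \<alpha> C \<Delta> i j \<and> \<Phi> (beta R \<alpha> C \<Delta> i) = (i, n) \<longrightarrow>
           \<Phi> (beta R \<alpha> C \<Delta> j) = (j, (n + 1) mod (2 * int (coxeter_number C)))) \<and>
        (\<forall>b\<in>orbit_of C (beta R \<alpha> C \<Delta> i0). \<Phi> b = \<Phi>0 b))"

section \<open>Height functions\<close>

definition height_function ::
    "'a::euclidean_space set \<Rightarrow> ('a set \<Rightarrow> 'i \<Rightarrow> 'a) \<Rightarrow> ('i \<Rightarrow> bit) \<Rightarrow> nat \<Rightarrow> ('i \<Rightarrow> int) \<Rightarrow> bool" where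
  "height_function R \<alpha> p h \<eta> \<longleftrightarrow>
     (\<forall>i. \<eta> i \<in> Z2h h) \<and>
     (\<forall>i j. adjacent R \<alpha> i j \<longrightarrow>
        \<eta> j = (\<eta> i + 1) mod (2 * int h) \<or> \<eta> j = (\<eta> i - 1) mod (2 * int h)) \<and>
     (\<forall>i. of_int (\<eta> i) = p i)"

definition height_of ::
    "'a::euclidean_space set \<Rightarrow> ('a set \<Rightarrow> 'i \<Rightarrow> 'a) \<Rightarrow> ('a \<Rightarrow> 'a) \<Rightarrow> ('a \<Rightarrow> 'i \<times> int)
      \<Rightarrow> 'a set \<Rightarrow> 'i \<Rightarrow> int" where
  "height_of R \<alpha> C \<Phi> \<Delta> i = snd (\<Phi> (beta R \<alpha> C \<Delta> i))"

end

theory Submission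
  imports Defs
begin

text \<open>Reflecting a compatible simple system in a source \<open>i\<close> of its orientation rotates the Coxeter word, so
  the new system is again compatible, \<open>\<beta>\<^sub>i\<close> becomes \<open>C \<beta>\<^sub>i\<close>, and the height at \<open>i\<close> rises by 2. Lifted to the
  integers (the Dynkin diagram is a forest), any height function is reached from any other, up to a
  multiple of \<open>2 h\<close>, by such moves. Conversely the heights determine the orientation and, \<open>\<Phi>\<close> being
  injective, the \<open>\<beta>\<^sub>i\<close>, from which \<open>\<alpha>\<^sub>i\<close> is recovered by subtracting the \<open>\<beta>\<^sub>j\<close> with \<open>j \<rightarrow> i\<close>.\<close>

section \<open>Reflections\<close>

text \<open>The vectors \<beta> are defined by paths in an orientation, while a move at a source
  changes a word of reflections. One identity links them: the part of a Coxeter word before the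
  letter \<open>i\<close>, applied to \<open>\<alpha> \<Delta> i\<close>, is
  \<open>\<beta> \<Delta> i\<close>. It rests on a recursion along arrows that counts paths, whereas
  the definition counts vertices; they agree because no vertex reaches another by two paths. So the
  forest property is needed twice, here and for the lift, and both times it comes from positive
  definiteness, without a classification. Two facts usually taken for granted are extracted from
  \<Phi>. That h >= 2 follows from its injectivity and from C moving some root. Since then 1 and -1
  differ modulo 2h, and every arrow raises the height by 1, no two expressions of C in one simple
  system orient an edge differently. Moves upward suffice: heights live modulo 2h, so the integer
  target may be shifted above the start.\<close>

lemma linear_root_reflection: "linear (root_reflection a)"
  unfolding root_reflection_def
  by (intro linearI) (simp_all add: algebra_simps inner_add_left add_divide_distrib)

lemma inner_root_reflection [simp]: "root_reflection a x \<bullet> root_reflection a y = x \<bullet> y"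
  by (cases "a = 0")
    (simp_all add: root_reflection_def inner_diff_left inner_diff_right inner_commute field_simps)

lemma root_reflection_involution [simp]: "root_reflection a (root_reflection a x) = x"
  by (cases "a = 0") (simp_all add: root_reflection_def inner_diff_left field_simps)

lemma root_reflection_self [simp]: "root_reflection a a = - a"
  by (cases "a = 0") (simp_all add: root_reflection_def scaleR_2)

lemma root_reflection_uminus [simp]: "root_reflection (- a) = root_reflection a"
  by (rule ext) (simp add: root_reflection_def)

lemma root_reflection_conj:
  assumes "linear w" and "\<And>x y. w x \<bullet> w y = x \<bullet> y"
  shows "root_reflection (w a) (w x) = w (root_reflection a x)"
  using assms by (simp add: root_reflection_def linear_diff linear_scale)

lemma reflection_product_simps [simp]:
  "reflection_product [] = id"
  "reflection_product (a # as) = root_reflection a \<circ> reflection_product as"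
  by (simp_all add: reflection_product_def)

lemma reflection_product_append [simp]:
  "reflection_product (as @ bs) = reflection_product as \<circ> reflection_product bs"
  by (induction as) (simp_all add: comp_assoc)

lemma linear_reflection_product: "linear (reflection_product as)"
proof (induction as)
  case Nil
  show ?case by (simp add: linear_iff)
next
  case (Cons a as)
  then show ?case
    by (simp only: reflection_product_simps linear_compose linear_root_reflection)
qed

lemma reflection_product_conj:
  assumes "linear w" and "\<And>x y. w x \<bullet> w y = x \<bullet> y"
  shows "reflection_product (map w as) (w x) = w (reflection_product as x)"
  by (induction as) (simp_all add: root_reflection_conj[OF assms])

text \<open>Each factor changes its argument by a multiple of its own root. This later prevents a
  Coxeter element from fixing the simple root at the head of its word.\<close>

lemma reflection_product_diff_in_span: "x - reflection_product as x \<in> span (set as)"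
proof (induction as)
  case Nil
  show ?case by (simp add: span_zero)
next
  case (Cons a as)
  let ?y = "reflection_product as x"
  have "x - ?y \<in> span (set (a # as))"
    using Cons span_mono[of "set as" "set (a # as)"] by auto
  moreover have "?y - root_reflection a ?y \<in> span (set (a # as))"
    by (simp add: root_reflection_def span_base span_scale)
  ultimately have "(x - ?y) + (?y - root_reflection a ?y) \<in> span (set (a # as))"
    by (rule span_add)
  then show ?case by simp
qed

text \<open>Lets the letter of a source be pulled to the front of a Coxeter word.\<close>

lemma reflection_product_orthogonal_commute:
  assumes "\<forall>b\<in>set as. b \<bullet> a = 0"
  shows "reflection_product as (root_reflection a x) = root_reflection a (reflection_product as x)"
  using assms
proof (induction as)
  case (Cons b as)
  have "root_reflection b (root_reflection a y) = root_reflection a (root_reflection b y)" for y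
    using Cons.prems
    by (simp add: root_reflection_def inner_diff_left inner_commute algebra_simps)
  with Cons show ?case by simp
qed simp

section \<open>Simple systems of a simply-laced root system\<close>

locale simply_laced_root_system =
  fixes R :: "'a::euclidean_space set"
  assumes root_sys: "root_system R"
    and reduced: "reduced_system R"
    and simply_laced: "simply_laced_normalized R"
begin

lemma finite_R: "finite R" and zero_notin_R: "0 \<notin> R"
  using root_sys by (auto simp: root_system_def)

lemma inner_self: "a \<in> R \<Longrightarrow> a \<bullet> a = 2"
  using simply_laced by (simp add: simply_laced_normalized_def)

lemma root_reflection_root: "a \<in> R \<Longrightarrow> root_reflection a x = x - (x \<bullet> a) *\<^sub>R a"
  by (simp add: root_reflection_def inner_self)

lemma root_reflection_in_R: "a \<in> R \<Longrightarrow> b \<in> R \<Longrightarrow> root_reflection a b \<in> R"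
  using root_sys by (auto simp: root_system_def)

lemma inner_Ints: "a \<in> R \<Longrightarrow> b \<in> R \<Longrightarrow> b \<bullet> a \<in> \<int>"
  using root_sys inner_self by (force simp: root_system_def)

lemma uminus_in_R: "a \<in> R \<Longrightarrow> - a \<in> R"
  using root_reflection_in_R[of a a] by simp

lemma scaleR_in_R: "a \<in> R \<Longrightarrow> c *\<^sub>R a \<in> R \<Longrightarrow> c \<ge> 0 \<Longrightarrow> c = 1"
  using reduced by (fastforce simp: reduced_system_def)

lemma reflection_product_in_R:
  "set as \<subseteq> R \<Longrightarrow> b \<in> R \<Longrightarrow> reflection_product as b \<in> R"
  by (induction as) (simp_all add: root_reflection_in_R)

lemma root_reflection_weyl: "a \<in> R \<Longrightarrow> root_reflection a \<in> weyl_group R"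
  using weyl_step[OF _ weyl_id, of a R] by simp

lemma simple_system_root_reflection:
  assumes a: "a \<in> R" and D: "simple_system R \<Delta>"
  shows "simple_system R (root_reflection a ` \<Delta>)"
proof -
  let ?s = "root_reflection a"
  have inj: "inj ?s" by (metis injI root_reflection_involution)
  have sub: "\<Delta> \<subseteq> R" and ind: "independent \<Delta>" using D by (auto simp: simple_system_def)
  have "\<exists>c::'a \<Rightarrow> int. b = (\<Sum>x\<in>?s ` \<Delta>. of_int (c x) *\<^sub>R x) \<and>
        ((\<forall>x\<in>?s ` \<Delta>. c x \<ge> 0) \<or> (\<forall>x\<in>?s ` \<Delta>. c x \<le> 0))" if b: "b \<in> R" for b
  proof -
    from D root_reflection_in_R[OF a b] obtain c :: "'a \<Rightarrow> int" where
      c: "?s b = (\<Sum>x\<in>\<Delta>. of_int (c x) *\<^sub>R x)"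
      and sgn: "(\<forall>x\<in>\<Delta>. c x \<ge> 0) \<or> (\<forall>x\<in>\<Delta>. c x \<le> 0)"
      unfolding simple_system_def by blast
    have "b = ?s (\<Sum>x\<in>\<Delta>. of_int (c x) *\<^sub>R x)" by (simp flip: c)
    also have "\<dots> = (\<Sum>x\<in>\<Delta>. of_int (c x) *\<^sub>R ?s x)"
      by (simp add: linear_sum[OF linear_root_reflection] linear_scale[OF linear_root_reflection])
    also have "\<dots> = (\<Sum>x\<in>?s ` \<Delta>. of_int (c (?s x)) *\<^sub>R x)"
      by (subst sum.reindex) (auto intro: inj_on_subset[OF inj])
    finally show ?thesis using sgn by (intro exI[of _ "c \<circ> ?s"]) auto
  qed
  moreover have "independent (?s ` \<Delta>)"
    by (intro linear_independent_injective_image linear_root_reflection ind inj_on_subset[OF inj]) simp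
  ultimately show ?thesis
    using sub root_reflection_in_R[OF a] by (auto simp: simple_system_def)
qed

section \<open>Positive roots, and the passage between simple systems by simple reflections\<close>

text \<open>The coefficients are real so that expansions can be composed and compared by linear
  independence; for a simple system, uniqueness makes them the integer ones.\<close>

definition positive_roots :: "'a set \<Rightarrow> 'a set" where
  "positive_roots \<Delta> =
    {b \<in> R. \<exists>c::'a \<Rightarrow> real. (\<forall>x\<in>\<Delta>. c x \<ge> 0) \<and> b = (\<Sum>x\<in>\<Delta>. c x *\<^sub>R x)}"

lemma simple_system_finite: "simple_system R \<Delta> \<Longrightarrow> finite \<Delta>"
  unfolding simple_system_def using finite_R finite_subset by auto

lemma simple_system_coeffs_unique:
  assumes "simple_system R \<Delta>" and "(\<Sum>x\<in>\<Delta>. c x *\<^sub>R x) = (\<Sum>x\<in>\<Delta>. d x *\<^sub>R x)" and "x \<in> \<Delta>"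
  shows "c x = d x"
proof -
  have "(\<Sum>x\<in>\<Delta>. (c x - d x) *\<^sub>R x) = 0"
    using assms(2) by (simp add: scaleR_diff_left sum_subtractf)
  moreover have "independent \<Delta>" using assms(1) by (simp add: simple_system_def)
  ultimately have "c x - d x = 0"
    using independentD[of \<Delta> \<Delta> "\<lambda>x. c x - d x" x] assms(3) simple_system_finite[OF assms(1)] by auto
  then show ?thesis by simp
qed

lemma root_positive_or_negative:
  assumes D: "simple_system R \<Delta>" and b: "b \<in> R"
  shows "b \<in> positive_roots \<Delta> \<or> - b \<in> positive_roots \<Delta>"
proof -
  from D b obtain c :: "'a \<Rightarrow> int" where
    c: "b = (\<Sum>x\<in>\<Delta>. of_int (c x) *\<^sub>R x)" and "(\<forall>x\<in>\<Delta>. c x \<ge> 0) \<or> (\<forall>x\<in>\<Delta>. c x \<le> 0)"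
    unfolding simple_system_def by blast
  then consider "\<forall>x\<in>\<Delta>. c x \<ge> 0" | "\<forall>x\<in>\<Delta>. c x \<le> 0" by blast
  then show ?thesis
  proof cases
    case 1
    then have "b \<in> positive_roots \<Delta>"
      using b c unfolding positive_roots_def by (auto intro!: exI[of _ "\<lambda>x. of_int (c x)"])
    then show ?thesis ..
  next
    case 2
    then have "- b \<in> positive_roots \<Delta>"
      using uminus_in_R[OF b] c unfolding positive_roots_def
      by (auto intro!: exI[of _ "\<lambda>x. - of_int (c x)"] simp: sum_negf)
    then show ?thesis ..
  qed
qed

lemma not_positive_and_negative:
  assumes D: "simple_system R \<Delta>" and "b \<in> positive_roots \<Delta>" and "- b \<in> positive_roots \<Delta>"
  shows False
proof -
  from assms obtain c d :: "'a \<Rightarrow> real" where c: "\<forall>x\<in>\<Delta>. c x \<ge> 0" "b = (\<Sum>x\<in>\<Delta>. c x *\<^sub>R x)"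
    and d: "\<forall>x\<in>\<Delta>. d x \<ge> 0" "- b = (\<Sum>x\<in>\<Delta>. d x *\<^sub>R x)" and b: "b \<in> R"
    unfolding positive_roots_def by blast
  have "(\<Sum>x\<in>\<Delta>. c x *\<^sub>R x) = (\<Sum>x\<in>\<Delta>. (- d x) *\<^sub>R x)"
    using c(2) d(2) by (simp add: sum_negf) (metis minus_minus)
  then have "c x = - d x" if "x \<in> \<Delta>" for x
    by (rule simple_system_coeffs_unique[OF D _ that])
  then have "c x = 0" if "x \<in> \<Delta>" for x using c(1) d(1) that by force
  then have "b = 0" using c(2) by simp
  then show False using b zero_notin_R by simp
qed

lemma simple_root_positive:
  assumes D: "simple_system R \<Delta>" and a: "a \<in> \<Delta>"
  shows "a \<in> positive_roots \<Delta>"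
proof -
  have "(\<Sum>x\<in>\<Delta>. (if x = a then 1 else 0) *\<^sub>R x) = a"
    using a simple_system_finite[OF D] by (simp add: if_distrib[of "\<lambda>c. c *\<^sub>R _"] cong: if_cong)
  then show ?thesis
    using a D unfolding positive_roots_def simple_system_def
    by (auto intro!: exI[of _ "\<lambda>x. if x = a then 1 else 0"])
qed

lemma positive_roots_subset:
  assumes D': "simple_system R \<Delta>'" and sub: "\<Delta> \<subseteq> positive_roots \<Delta>'"
  shows "positive_roots \<Delta> \<subseteq> positive_roots \<Delta>'"
proof
  fix b assume "b \<in> positive_roots \<Delta>"
  then obtain c :: "'a \<Rightarrow> real" where b: "b \<in> R" and c: "\<forall>x\<in>\<Delta>. c x \<ge> 0" "b = (\<Sum>x\<in>\<Delta>. c x *\<^sub>R x)"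
    unfolding positive_roots_def by blast
  have "\<forall>x\<in>\<Delta>. \<exists>d::'a \<Rightarrow> real. (\<forall>y\<in>\<Delta>'. d y \<ge> 0) \<and> x = (\<Sum>y\<in>\<Delta>'. d y *\<^sub>R y)"
    using sub unfolding positive_roots_def by auto
  then obtain d :: "'a \<Rightarrow> 'a \<Rightarrow> real" where
    d: "\<And>x y. x \<in> \<Delta> \<Longrightarrow> y \<in> \<Delta>' \<Longrightarrow> d x y \<ge> 0" "\<And>x. x \<in> \<Delta> \<Longrightarrow> x = (\<Sum>y\<in>\<Delta>'. d x y *\<^sub>R y)"
    by metis
  have "b = (\<Sum>x\<in>\<Delta>. c x *\<^sub>R (\<Sum>y\<in>\<Delta>'. d x y *\<^sub>R y))"
    unfolding c(2) by (rule sum.cong) (use d(2) in auto)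
  also have "\<dots> = (\<Sum>y\<in>\<Delta>'. (\<Sum>x\<in>\<Delta>. c x * d x y) *\<^sub>R y)"
    by (subst scaleR_sum_right, subst sum.swap) (simp add: scaleR_sum_left)
  finally show "b \<in> positive_roots \<Delta>'"
    using b c(1) d(1) unfolding positive_roots_def
    by (auto intro!: exI[of _ "\<lambda>y. \<Sum>x\<in>\<Delta>. c x * d x y"] sum_nonneg)
qed

text \<open>As the system is reduced, a positive root other than \<open>a\<close> has a positive
  coefficient at some simple root besides \<open>a\<close>. The reflection changes only the
  coefficient at \<open>a\<close>, so the image cannot be negative.\<close>

lemma root_reflection_positive:
  assumes D: "simple_system R \<Delta>" and a: "a \<in> \<Delta>" and b: "b \<in> positive_roots \<Delta>" and ne: "b \<noteq> a"
  shows "root_reflection a b \<in> positive_roots \<Delta>"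
proof (rule ccontr)
  assume neg: "root_reflection a b \<notin> positive_roots \<Delta>"
  have fin: "finite \<Delta>" and aR: "a \<in> R"
    using D a simple_system_finite by (auto simp: simple_system_def)
  from b obtain c :: "'a \<Rightarrow> real" where bR: "b \<in> R"
    and c: "\<forall>x\<in>\<Delta>. c x \<ge> 0" "b = (\<Sum>x\<in>\<Delta>. c x *\<^sub>R x)"
    unfolding positive_roots_def by blast
  have "\<exists>y\<in>\<Delta>. y \<noteq> a \<and> c y > 0"
  proof (rule ccontr)
    assume "\<not> ?thesis"
    then have "(\<Sum>x\<in>\<Delta>. c x *\<^sub>R x) = (\<Sum>x\<in>{a}. c x *\<^sub>R x)"
      using c(1) a fin by (intro sum.mono_neutral_right) force+
    then have "b = c a *\<^sub>R a" using c(2) by simp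
    moreover have "c a = 1"
      using scaleR_in_R[OF aR, of "c a"] bR c(1) a \<open>b = c a *\<^sub>R a\<close> by simp
    ultimately show False using ne by simp
  qed
  then obtain y where y: "y \<in> \<Delta>" "y \<noteq> a" "c y > 0" by blast
  have "- root_reflection a b \<in> positive_roots \<Delta>"
    using root_positive_or_negative[OF D root_reflection_in_R[OF aR bR]] neg by blast
  then obtain d :: "'a \<Rightarrow> real" where
    d: "\<forall>x\<in>\<Delta>. d x \<ge> 0" "- root_reflection a b = (\<Sum>x\<in>\<Delta>. d x *\<^sub>R x)"
    unfolding positive_roots_def by blast
  have "(\<Sum>x\<in>\<Delta>. (if x = a then b \<bullet> a else 0) *\<^sub>R x) = (b \<bullet> a) *\<^sub>R a"
    using a fin by (simp add: if_distrib[of "\<lambda>c. c *\<^sub>R _"] cong: if_cong)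
  then have "(\<Sum>x\<in>\<Delta>. (c x - (if x = a then b \<bullet> a else 0)) *\<^sub>R x) = root_reflection a b"
    using c(2) by (simp add: scaleR_diff_left sum_subtractf root_reflection_root[OF aR])
  also have "\<dots> = (\<Sum>x\<in>\<Delta>. (- d x) *\<^sub>R x)"
    using d(2) by (simp add: sum_negf) (metis minus_minus)
  finally have "c y - (if y = a then b \<bullet> a else 0) = - d y"
    by (rule simple_system_coeffs_unique[OF D _ y(1)])
  then show False using y d(1) by force
qed

text \<open>Simple roots span the extreme rays of the cone of positive roots. When \<open>a\<close>
  is expanded in \<open>\<Delta>'\<close> and back in \<open>\<Delta>\<close>, nothing can cancel,
  so every \<open>x\<close> with a positive coefficient is a multiple of \<open>a\<close>, and
  reducedness gives x = a.\<close>

lemma simple_system_subset_of_positive_eq: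
  assumes D: "simple_system R \<Delta>" and D': "simple_system R \<Delta>'"
    and eq: "positive_roots \<Delta> = positive_roots \<Delta>'"
  shows "\<Delta> \<subseteq> \<Delta>'"
proof
  fix a assume a: "a \<in> \<Delta>"
  have fin: "finite \<Delta>" "finite \<Delta>'" and aR: "a \<in> R"
    using D D' a simple_system_finite by (auto simp: simple_system_def)
  have "a \<in> positive_roots \<Delta>'" using simple_root_positive[OF D a] eq by simp
  then obtain c :: "'a \<Rightarrow> real" where c: "\<forall>x\<in>\<Delta>'. c x \<ge> 0" "a = (\<Sum>x\<in>\<Delta>'. c x *\<^sub>R x)"
    unfolding positive_roots_def by blast
  have "\<forall>x\<in>\<Delta>'. \<exists>d::'a \<Rightarrow> real. (\<forall>y\<in>\<Delta>. d y \<ge> 0) \<and> x = (\<Sum>y\<in>\<Delta>. d y *\<^sub>R y)"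
  proof
    fix x assume "x \<in> \<Delta>'"
    then have "x \<in> positive_roots \<Delta>" using simple_root_positive[OF D'] eq by simp
    then show "\<exists>d::'a \<Rightarrow> real. (\<forall>y\<in>\<Delta>. d y \<ge> 0) \<and> x = (\<Sum>y\<in>\<Delta>. d y *\<^sub>R y)"
      unfolding positive_roots_def by blast
  qed
  then obtain d :: "'a \<Rightarrow> 'a \<Rightarrow> real" where
    d: "\<And>x y. x \<in> \<Delta>' \<Longrightarrow> y \<in> \<Delta> \<Longrightarrow> d x y \<ge> 0" "\<And>x. x \<in> \<Delta>' \<Longrightarrow> x = (\<Sum>y\<in>\<Delta>. d x y *\<^sub>R y)"
    by metis
  have "(\<Sum>y\<in>\<Delta>. (if y = a then 1 else 0) *\<^sub>R y) = a"
    using a fin by (simp add: if_distrib[of "\<lambda>c. c *\<^sub>R _"] cong: if_cong)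
  also have "a = (\<Sum>x\<in>\<Delta>'. c x *\<^sub>R (\<Sum>y\<in>\<Delta>. d x y *\<^sub>R y))"
    by (subst c(2), rule sum.cong) (use d(2) in auto)
  also have "\<dots> = (\<Sum>y\<in>\<Delta>. (\<Sum>x\<in>\<Delta>'. c x * d x y) *\<^sub>R y)"
    by (subst scaleR_sum_right, subst sum.swap) (simp add: scaleR_sum_left)
  finally have coeff: "(if y = a then 1 else 0) = (\<Sum>x\<in>\<Delta>'. c x * d x y)" if "y \<in> \<Delta>" for y
    by (rule simple_system_coeffs_unique[OF D _ that])
  have "\<exists>x\<in>\<Delta>'. c x > 0"
  proof (rule ccontr)
    assume "\<not> ?thesis"
    then have "\<forall>x\<in>\<Delta>'. c x = 0" using c(1) by force
    then have "a = 0" using c(2) by simp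
    then show False using aR zero_notin_R by simp
  qed
  then obtain x where x: "x \<in> \<Delta>'" "c x > 0" by blast
  have zero: "d x y = 0" if "y \<in> \<Delta>" "y \<noteq> a" for y
  proof -
    have "(\<Sum>x\<in>\<Delta>'. c x * d x y) = 0" using coeff[OF that(1)] that(2) by simp
    then have "c x * d x y = 0"
      using sum_nonneg_eq_0_iff[OF fin(2), of "\<lambda>x. c x * d x y"] c(1) d(1) that(1) x(1) by simp
    then show ?thesis using x(2) by simp
  qed
  have "(\<Sum>y\<in>\<Delta>. d x y *\<^sub>R y) = (\<Sum>y\<in>{a}. d x y *\<^sub>R y)"
    using zero a fin by (intro sum.mono_neutral_right) auto
  then have "x = d x a *\<^sub>R a" using d(2)[OF x(1)] by simp
  moreover have "x \<in> R" using x(1) D' by (auto simp: simple_system_def)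
  ultimately show "a \<in> \<Delta>'"
    using scaleR_in_R[OF aR, of "d x a"] d(1)[OF x(1) a] x(1) by auto
qed

text \<open>Simple reflections connect any two simple systems. Reflecting in a simple root of
  \<open>\<Delta>\<close> that is negative for \<open>\<Delta>'\<close> exchanges only that root
  with its negative, so fewer roots are positive for \<open>\<Delta>\<close> but not for
  \<open>\<Delta>'\<close>. If there is no such simple root, the two systems coincide.\<close>

lemma simple_system_induct:
  assumes D': "simple_system R \<Delta>'" and D: "simple_system R \<Delta>"
    and base: "P \<Delta>'"
    and step: "\<And>\<Delta> a. simple_system R \<Delta> \<Longrightarrow> a \<in> \<Delta> \<Longrightarrow> P (root_reflection a ` \<Delta>) \<Longrightarrow> P \<Delta>"
  shows "P \<Delta>"
  using D
proof (induction "card (positive_roots \<Delta> - positive_roots \<Delta>')" arbitrary: \<Delta> rule: less_induct)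
  case less
  have fin: "finite (positive_roots \<Gamma>)" for \<Gamma>
    using finite_R by (simp add: positive_roots_def)
  show ?case
  proof (cases "\<Delta> \<subseteq> positive_roots \<Delta>'")
    case True
    have "positive_roots \<Delta> \<subseteq> positive_roots \<Delta>'" by (rule positive_roots_subset[OF D' True])
    moreover have "positive_roots \<Delta>' \<subseteq> positive_roots \<Delta>"
    proof
      fix b assume b: "b \<in> positive_roots \<Delta>'"
      then have "b \<in> R" by (simp add: positive_roots_def)
      then show "b \<in> positive_roots \<Delta>"
        using root_positive_or_negative[OF less.prems] not_positive_and_negative[OF D' b]
          \<open>positive_roots \<Delta> \<subseteq> positive_roots \<Delta>'\<close> by blast
    qed
    ultimately have "positive_roots \<Delta> = positive_roots \<Delta>'" by blast
    then have "\<Delta> = \<Delta>'"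
      using simple_system_subset_of_positive_eq D' less.prems by (metis subset_antisym)
    then show ?thesis using base by simp
  next
    case False
    then obtain a where a: "a \<in> \<Delta>" "a \<notin> positive_roots \<Delta>'" by blast
    let ?s = "root_reflection a"
    have aR: "a \<in> R" using a(1) less.prems by (auto simp: simple_system_def)
    have sD: "simple_system R (?s ` \<Delta>)" by (rule simple_system_root_reflection[OF aR less.prems])
    have neg: "- a \<in> positive_roots \<Delta>'" using root_positive_or_negative[OF D' aR] a(2) by blast
    have "positive_roots (?s ` \<Delta>) \<subseteq> insert (- a) (positive_roots \<Delta> - {a})"
    proof
      fix b assume b: "b \<in> positive_roots (?s ` \<Delta>)"
      then obtain c :: "'a \<Rightarrow> real" where bR: "b \<in> R"
        and c: "\<forall>x\<in>?s ` \<Delta>. c x \<ge> 0" "b = (\<Sum>x\<in>?s ` \<Delta>. c x *\<^sub>R x)"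
        unfolding positive_roots_def by blast
      have "inj_on ?s \<Delta>" by (metis inj_onI root_reflection_involution)
      then have "b = (\<Sum>x\<in>\<Delta>. c (?s x) *\<^sub>R ?s x)" using c(2) by (simp add: sum.reindex)
      then have "?s b = (\<Sum>x\<in>\<Delta>. c (?s x) *\<^sub>R x)"
        by (simp add: linear_sum[OF linear_root_reflection] linear_scale[OF linear_root_reflection])
      then have sb: "?s b \<in> positive_roots \<Delta>"
        using c(1) root_reflection_in_R[OF aR bR] unfolding positive_roots_def
        by (auto intro!: exI[of _ "\<lambda>x. c (?s x)"])
      show "b \<in> insert (- a) (positive_roots \<Delta> - {a})"
      proof (cases "?s b = a")
        case True
        then show ?thesis by (metis insertI1 root_reflection_involution root_reflection_self)
      next
        case False
        then have "b \<in> positive_roots \<Delta>"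
          using root_reflection_positive[OF less.prems a(1) sb] by simp
        moreover have "b \<noteq> a"
          using sb not_positive_and_negative[OF less.prems simple_root_positive[OF less.prems a(1)]] by auto
        ultimately show ?thesis by simp
      qed
    qed
    then have "positive_roots (?s ` \<Delta>) - positive_roots \<Delta>' \<subseteq> (positive_roots \<Delta> - positive_roots \<Delta>') - {a}"
      using neg by auto
    moreover have "a \<in> positive_roots \<Delta> - positive_roots \<Delta>'"
      using a simple_root_positive[OF less.prems] by blast
    ultimately have "card (positive_roots (?s ` \<Delta>) - positive_roots \<Delta>') < card (positive_roots \<Delta> - positive_roots \<Delta>')"
      using fin by (intro psubset_card_mono) auto
    then have "P (?s ` \<Delta>)" using less.hyps sD by blast
    then show ?thesis by (rule step[OF less.prems a(1)])
  qed
qed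

text \<open>The product is an integer. It is at most 0 because reflecting \<open>b\<close> in
  \<open>a\<close> gives a positive root, whose coefficient at \<open>a\<close> is minus the
  product; it exceeds -2 because a + b is a nonzero vector of square length 4 + 2 (a, b).\<close>

lemma inner_simple_roots:
  assumes D: "simple_system R \<Delta>" and a: "a \<in> \<Delta>" and b: "b \<in> \<Delta>" and ne: "a \<noteq> b"
  shows "a \<bullet> b = 0 \<or> a \<bullet> b = -1"
proof -
  have aR: "a \<in> R" and bR: "b \<in> R" and fin: "finite \<Delta>"
    using D a b simple_system_finite by (auto simp: simple_system_def)
  obtain k :: int where k: "a \<bullet> b = of_int k"
    using inner_Ints[OF bR aR] by (auto elim: Ints_cases)
  have "(\<Sum>x\<in>\<Delta>. ((if x = b then 1 else 0) - (if x = a then a \<bullet> b else 0)) *\<^sub>R x) = root_reflection a b"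
    using a b fin
    by (simp add: scaleR_diff_left sum_subtractf root_reflection_root[OF aR] inner_commute
        if_distrib[of "\<lambda>c. c *\<^sub>R _"] cong: if_cong)
  moreover have "root_reflection a b \<in> positive_roots \<Delta>"
    using root_reflection_positive[OF D a simple_root_positive[OF D b]] ne by simp
  then obtain c :: "'a \<Rightarrow> real" where
    c: "\<forall>x\<in>\<Delta>. c x \<ge> 0" "root_reflection a b = (\<Sum>x\<in>\<Delta>. c x *\<^sub>R x)"
    unfolding positive_roots_def by blast
  ultimately have "(if a = b then 1 else 0) - (if a = a then a \<bullet> b else 0) = c a"
    by (intro simple_system_coeffs_unique[OF D _ a]) simp
  then have "a \<bullet> b \<le> 0" using c(1) a ne by force
  moreover have "a + b \<noteq> 0"
    using simple_root_positive[OF D] a b not_positive_and_negative[OF D]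
    by (metis add_eq_0_iff)
  then have "(a + b) \<bullet> (a + b) > 0" by simp
  then have "a \<bullet> b > - 2"
    using inner_self[OF aR] inner_self[OF bR] by (simp add: inner_add_left inner_add_right inner_commute)
  ultimately have "k \<le> 0" "k > -2" using k by simp_all
  then have "k = 0 \<or> k = -1" by arith
  then show ?thesis using k by auto
qed

end

section \<open>The Dynkin diagram\<close>

locale indexed_root_system = simply_laced_root_system R
  for R :: "'a::euclidean_space set" +
  fixes \<alpha> :: "'a set \<Rightarrow> 'i \<Rightarrow> 'a"
  assumes indexing: "simple_root_indexing R \<alpha>"
    and ex_simple_system: "\<exists>\<Delta>. simple_system R \<Delta>"
begin

abbreviation adj :: "'i \<Rightarrow> 'i \<Rightarrow> bool" where
  "adj \<equiv> adjacent R \<alpha>"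

lemma bij_alpha: "simple_system R \<Delta> \<Longrightarrow> bij_betw (\<alpha> \<Delta>) UNIV \<Delta>"
  using indexing by (simp add: simple_root_indexing_def)

lemma alpha_in: "simple_system R \<Delta> \<Longrightarrow> \<alpha> \<Delta> i \<in> \<Delta>"
  using bij_alpha bij_betwE by blast

lemma alpha_in_R: "simple_system R \<Delta> \<Longrightarrow> \<alpha> \<Delta> i \<in> R"
  using alpha_in by (auto simp: simple_system_def)

lemma alpha_eq_iff: "simple_system R \<Delta> \<Longrightarrow> \<alpha> \<Delta> i = \<alpha> \<Delta> j \<longleftrightarrow> i = j"
  using bij_alpha by (auto simp: bij_betw_def inj_on_def)

lemma range_alpha: "simple_system R \<Delta> \<Longrightarrow> range (\<alpha> \<Delta>) = \<Delta>"
  using bij_alpha by (simp add: bij_betw_def)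

lemma alpha_root_reflection:
  "simple_system R \<Delta> \<Longrightarrow> a \<in> R \<Longrightarrow> \<alpha> (root_reflection a ` \<Delta>) i = root_reflection a (\<alpha> \<Delta> i)"
  using indexing root_reflection_weyl unfolding simple_root_indexing_def by metis

lemma finite_index: "finite (A :: 'i set)"
proof -
  obtain \<Delta> where "simple_system R \<Delta>" using ex_simple_system ..
  then have "finite (UNIV :: 'i set)"
    using bij_alpha simple_system_finite bij_betw_finite by blast
  then show ?thesis by (rule finite_subset[OF subset_UNIV])
qed

text \<open>Simple reflections are isometries compatible with the indexing, so the value is constant
  along a chain joining the two systems. This reconciles the existential quantifier in
  \<open>adjacent\<close> with a computation in any given system.\<close>

lemma inner_alpha_independent:
  assumes D: "simple_system R \<Delta>" and D': "simple_system R \<Delta>'"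
  shows "\<alpha> \<Delta> i \<bullet> \<alpha> \<Delta> j = \<alpha> \<Delta>' i \<bullet> \<alpha> \<Delta>' j"
proof (rule simple_system_induct[OF D' D])
  fix \<Gamma> a
  assume G: "simple_system R \<Gamma>" and a: "a \<in> \<Gamma>"
    and "\<alpha> (root_reflection a ` \<Gamma>) i \<bullet> \<alpha> (root_reflection a ` \<Gamma>) j = \<alpha> \<Delta>' i \<bullet> \<alpha> \<Delta>' j"
  moreover have "a \<in> R" using G a by (auto simp: simple_system_def)
  ultimately show "\<alpha> \<Gamma> i \<bullet> \<alpha> \<Gamma> j = \<alpha> \<Delta>' i \<bullet> \<alpha> \<Delta>' j"
    by (simp add: alpha_root_reflection)
qed simp

lemma inner_alpha:
  assumes D: "simple_system R \<Delta>"
  shows "\<alpha> \<Delta> i \<bullet> \<alpha> \<Delta> j = (if i = j then 2 else if adj i j then -1 else 0)"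
proof (cases "i = j")
  case True
  then show ?thesis using inner_self[OF alpha_in_R[OF D]] by simp
next
  case False
  have "adj i j \<longleftrightarrow> \<alpha> \<Delta> i \<bullet> \<alpha> \<Delta> j = -1"
    unfolding adjacent_def using False D inner_alpha_independent[OF D]
    by (metis minus_equation_iff)
  moreover have "\<alpha> \<Delta> i \<bullet> \<alpha> \<Delta> j = 0 \<or> \<alpha> \<Delta> i \<bullet> \<alpha> \<Delta> j = -1"
    using inner_simple_roots[OF D alpha_in[OF D] alpha_in[OF D]] False alpha_eq_iff[OF D] by blast
  ultimately show ?thesis using False by auto
qed

lemma adj_irrefl [simp]: "\<not> adj i i"
  by (simp add: adjacent_def)

lemma adj_sym: "adj i j \<Longrightarrow> adj j i"
  by (auto simp: adjacent_def inner_commute)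

section \<open>The forest property of the diagram\<close>

text \<open>The double sum is the square length of a sum of distinct, linearly independent roots.
  Every argument against cycles below contradicts this inequality.\<close>

lemma alpha_sum_positive:
  assumes D: "simple_system R \<Delta>" and "S \<noteq> {}"
  shows "(\<Sum>i\<in>S. \<Sum>j\<in>S. \<alpha> \<Delta> i \<bullet> \<alpha> \<Delta> j) > 0"
proof -
  let ?v = "\<Sum>i\<in>S. \<alpha> \<Delta> i"
  obtain i where i: "i \<in> S" using assms(2) by blast
  have "inj_on (\<alpha> \<Delta>) S" using alpha_eq_iff[OF D] by (auto intro: inj_onI)
  then have "?v = (\<Sum>x\<in>\<alpha> \<Delta> ` S. 1 *\<^sub>R x)" by (simp add: sum.reindex)
  moreover have "independent (\<alpha> \<Delta> ` S)"
    using D alpha_in[OF D] independent_mono[of \<Delta> "\<alpha> \<Delta> ` S"] by (auto simp: simple_system_def)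
  ultimately have "?v \<noteq> 0"
    using independentD[of "\<alpha> \<Delta> ` S" "\<alpha> \<Delta> ` S" "\<lambda>_. 1" "\<alpha> \<Delta> i"] i finite_index by auto
  then have "?v \<bullet> ?v > 0" by simp
  then show ?thesis by (simp add: inner_sum_left inner_sum_right) (subst sum.swap, simp)
qed

text \<open>If every vertex had two neighbours in \<open>S\<close>, each row sum of the Gram matrix
  on \<open>S\<close>, namely 2 minus the degree, would be nonpositive.\<close>

lemma ex_leaf:
  assumes "S \<noteq> {}"
  shows "\<exists>v\<in>S. card {u \<in> S. adj v u} \<le> 1"
proof (rule ccontr)
  assume "\<not> ?thesis"
  then have deg: "card {u \<in> S. adj v u} \<ge> 2" if "v \<in> S" for v using that by force
  obtain \<Delta> where D: "simple_system R \<Delta>" using ex_simple_system ..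
  have "(\<Sum>u\<in>S. \<alpha> \<Delta> v \<bullet> \<alpha> \<Delta> u) \<le> 0" if v: "v \<in> S" for v
  proof -
    have "(\<Sum>u\<in>S. \<alpha> \<Delta> v \<bullet> \<alpha> \<Delta> u) = (\<Sum>u\<in>S. (if v = u then 2 else 0) - (if adj v u then 1 else 0))"
      by (rule sum.cong) (auto simp: inner_alpha[OF D])
    also have "\<dots> = 2 - real (card {u \<in> S. adj v u})"
      using v finite_index by (simp add: sum_subtractf sum.If_cases Int_def)
    finally show ?thesis using deg[OF v] by simp
  qed
  then have "(\<Sum>v\<in>S. \<Sum>u\<in>S. \<alpha> \<Delta> v \<bullet> \<alpha> \<Delta> u) \<le> 0" by (rule sum_nonpos)
  then show False using alpha_sum_positive[OF D assms] by simp
qed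

text \<open>Leaf by leaf, a function on a forest whose steps along edges are \<open>\<plusminus> 1\<close> modulo \<open>m\<close> lifts to
  the integers.\<close>

lemma height_lift:
  fixes \<eta> :: "'i \<Rightarrow> int" and m :: int
  assumes red: "\<And>i. \<eta> i mod m = \<eta> i"
    and step: "\<And>i j. adj i j \<Longrightarrow> \<eta> j = (\<eta> i + 1) mod m \<or> \<eta> j = (\<eta> i - 1) mod m"
  shows "\<exists>f. (\<forall>i. f i mod m = \<eta> i) \<and> (\<forall>i j. adj i j \<longrightarrow> f j = f i + 1 \<or> f j = f i - 1)"
proof -
  have "\<exists>f. (\<forall>i\<in>S. f i mod m = \<eta> i) \<and>
      (\<forall>i\<in>S. \<forall>j\<in>S. adj i j \<longrightarrow> f j = f i + 1 \<or> f j = f i - 1)" for S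
  proof (induction "card S" arbitrary: S)
    case 0
    then show ?case using finite_index by simp
  next
    case (Suc n)
    then have "S \<noteq> {}" by auto
    then obtain v where v: "v \<in> S" "card {u \<in> S. adj v u} \<le> 1" using ex_leaf by blast
    have "n = card (S - {v})" using Suc.hyps(2) v(1) finite_index by simp
    then obtain f where f: "\<forall>i\<in>S - {v}. f i mod m = \<eta> i"
      "\<forall>i\<in>S - {v}. \<forall>j\<in>S - {v}. adj i j \<longrightarrow> f j = f i + 1 \<or> f j = f i - 1"
      using Suc.hyps(1) by blast
    \<comment> \<open>At most one neighbour of \<open>v\<close> lies in \<open>S\<close>, so the new
      value faces a single constraint, which can be met inside the residue class
      \<open>\<eta> v\<close>.\<close>
    have "\<exists>x. x mod m = \<eta> v \<and> (\<forall>u\<in>S. adj v u \<longrightarrow> x = f u + 1 \<or> x = f u - 1)"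
    proof (cases "\<exists>u\<in>S. adj v u")
      case False
      then show ?thesis using red by blast
    next
      case True
      then obtain u where u: "u \<in> S" "adj v u" by blast
      have only: "w = u" if "w \<in> S" "adj v w" for w
        using v(2) that u finite_index card_le_Suc0_iff_eq[of "{u \<in> S. adj v u}"] by auto
      have fu: "f u mod m = \<eta> u" using f(1) u by (metis DiffI adj_irrefl singletonD)
      from step[OF adj_sym[OF u(2)]] show ?thesis
      proof
        assume "\<eta> v = (\<eta> u + 1) mod m"
        then have "(f u + 1) mod m = \<eta> v" by (simp add: mod_add_left_eq flip: fu)
        then show ?thesis using only by blast
      next
        assume "\<eta> v = (\<eta> u - 1) mod m"
        then have "(f u - 1) mod m = \<eta> v" by (simp add: mod_diff_left_eq flip: fu)
        then show ?thesis using only by blast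
      qed
    qed
    then obtain x where x: "x mod m = \<eta> v" "\<And>u. u \<in> S \<Longrightarrow> adj v u \<Longrightarrow> x = f u + 1 \<or> x = f u - 1"
      by blast
    have "(f(v := x)) j = (f(v := x)) i + 1 \<or> (f(v := x)) j = (f(v := x)) i - 1"
      if iS: "i \<in> S" and jS: "j \<in> S" and ij: "adj i j" for i j
    proof -
      consider "i = v" "j \<noteq> v" | "j = v" "i \<noteq> v" | "i \<noteq> v" "j \<noteq> v"
        using ij by (cases "i = v"; cases "j = v") auto
      then show ?thesis
      proof cases
        case 1
        then show ?thesis using x(2)[OF jS] ij by auto
      next
        case 2
        then show ?thesis using x(2)[OF iS] adj_sym[OF ij] by auto
      next
        case 3
        then show ?thesis using f(2) iS jS ij by simp
      qed
    qed
    then show ?case using f(1) x(1) by (intro exI[of _ "f(v := x)"]) auto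
  qed
  from this[of UNIV] show ?thesis by simp
qed

text \<open>Choose \<open>i\<close> with \<open>f i\<close> minimal among the points where f < g. A
  neighbour with f j = f i - 1 would satisfy g j >= g i - 1 >= f i > f j, hence be such a point with
  a smaller value.\<close>

lemma ex_raisable_source:
  fixes f g :: "'i \<Rightarrow> int"
  assumes f: "\<And>i j. adj i j \<Longrightarrow> f j = f i + 1 \<or> f j = f i - 1"
    and g: "\<And>i j. adj i j \<Longrightarrow> g j = g i + 1 \<or> g j = g i - 1"
    and le: "\<And>i. f i \<le> g i" and ne: "f \<noteq> g"
  shows "\<exists>i. f i < g i \<and> (\<forall>j. adj i j \<longrightarrow> f j = f i + 1)"
proof -
  let ?T = "{i. f i < g i}"
  have "?T \<noteq> {}"
  proof
    assume "?T = {}"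
    then have "\<forall>i. g i \<le> f i" by (simp add: not_less)
    then have "f = g" using le by (intro ext antisym) auto
    with ne show False ..
  qed
  define i where "i = arg_min_on f ?T"
  have i: "f i < g i"
    using arg_min_if_finite(1)[OF finite_index \<open>?T \<noteq> {}\<close>, of f] by (simp add: i_def)
  have min: "f i \<le> f j" if "f j < g j" for j
    using arg_min_least[OF finite_index \<open>?T \<noteq> {}\<close>, of j f] that by (simp add: i_def)
  have "f j = f i + 1" if "adj i j" for j
    using f[OF that] g[OF that] min[of j] le[of j] i by force
  then show ?thesis using i by blast
qed

text \<open>Two different predecessors of \<open>i\<close> have no common ancestor \<open>k\<close>: otherwise the interval \<open>S\<close> from
  \<open>k\<close> to \<open>i\<close> has at least as many edges as vertices, and the sum of its simple roots has
  nonpositive square length.\<close>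

lemma common_ancestor_unique:
  fixes A :: "'i \<Rightarrow> 'i \<Rightarrow> bool" and f :: "'i \<Rightarrow> nat"
  assumes A: "\<And>i j. adj i j \<longleftrightarrow> A i j \<or> A j i" and f: "\<And>i j. A i j \<Longrightarrow> f i < f j"
    and 1: "A j1 i" "A\<^sup>*\<^sup>* k j1" and 2: "A j2 i" "A\<^sup>*\<^sup>* k j2"
  shows "j1 = j2"
proof (rule ccontr)
  assume ne: "j1 \<noteq> j2"
  obtain \<Delta> where D: "simple_system R \<Delta>" using ex_simple_system ..
  define S where "S = {m. A\<^sup>*\<^sup>* k m \<and> A\<^sup>*\<^sup>* m i}"
  define e :: "'i \<Rightarrow> 'i \<Rightarrow> real" where "e = (\<lambda>a b. if A a b then 1 else 0)"
  have mono: "f a \<le> f b" if "A\<^sup>*\<^sup>* a b" for a b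
    using that by induction (auto dest: f)
  have "f k < f i" using mono[OF 1(2)] f[OF 1(1)] by simp
  then have "k \<noteq> i" by auto
  have kS: "k \<in> S" and iS: "i \<in> S" and jS: "j1 \<in> S" "j2 \<in> S"
    unfolding S_def using 1 2 by (auto intro: rtranclp.rtrancl_into_rtrancl)
  \<comment> \<open>Arrows into \<open>b\<close> from inside \<open>S\<close>: two at
    \<open>i\<close>, from \<open>j1\<close> and \<open>j2\<close>, possibly none at
    \<open>k\<close>, at least one elsewhere. Surplus and deficit cancel in the sum, leaving at
    least \<open>card S\<close> edges.\<close>
  have indegree: "(\<Sum>a\<in>S. e a b) \<ge> 1 + (if b = i then 1 else 0) - (if b = k then 1 else 0)"
    if b: "b \<in> S" for b
  proof -
    have nonneg: "(\<Sum>a\<in>S. e a b) \<ge> (\<Sum>a\<in>T. e a b)" if "T \<subseteq> S" for T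
      using that finite_index by (intro sum_mono2) (auto simp: e_def)
    consider "b = k" | "b = i" | "b \<noteq> k" "b \<noteq> i" by blast
    then show ?thesis
    proof cases
      case 1
      then show ?thesis using nonneg[of "{}"] \<open>k \<noteq> i\<close> by simp
    next
      case 2
      then show ?thesis
        using nonneg[of "{j1, j2}"] jS ne \<open>A j1 i\<close> \<open>A j2 i\<close> \<open>k \<noteq> i\<close> by (simp add: e_def)
    next
      case 3
      have "A\<^sup>*\<^sup>* k b" using b by (simp add: S_def)
      then obtain a where a: "A\<^sup>*\<^sup>* k a" "A a b" using 3(1) by (metis rtranclp.cases)
      then have "a \<in> S"
        using b by (auto simp: S_def intro: converse_rtranclp_into_rtranclp)
      then show ?thesis using nonneg[of "{a}"] a(2) 3 by (simp add: e_def)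
    qed
  qed
  have "(\<Sum>b\<in>S. \<Sum>a\<in>S. e a b) \<ge> (\<Sum>b\<in>S. 1 + (if b = i then 1 else 0) - (if b = k then 1 else 0))"
    by (rule sum_mono) (rule indegree)
  then have edges: "(\<Sum>b\<in>S. \<Sum>a\<in>S. e a b) \<ge> real (card S)"
    using kS iS finite_index by (simp add: sum.distrib sum_subtractf)
  \<comment> \<open>The rank \<open>f\<close> excludes arrows in both directions, so an edge is
    subtracted only once.\<close>
  have "\<alpha> \<Delta> a \<bullet> \<alpha> \<Delta> b = (if a = b then 2 else 0) - e a b - e b a" for a b
    using f[of a b] f[of b a] by (auto simp: inner_alpha[OF D] A e_def)
  then have "(\<Sum>b\<in>S. \<Sum>a\<in>S. \<alpha> \<Delta> a \<bullet> \<alpha> \<Delta> b) =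
      2 * real (card S) - (\<Sum>b\<in>S. \<Sum>a\<in>S. e a b) - (\<Sum>b\<in>S. \<Sum>a\<in>S. e b a)"
    using finite_index by (simp add: sum_subtractf)
  also have "(\<Sum>b\<in>S. \<Sum>a\<in>S. e b a) = (\<Sum>b\<in>S. \<Sum>a\<in>S. e a b)" by (rule sum.swap)
  finally have "(\<Sum>b\<in>S. \<Sum>a\<in>S. \<alpha> \<Delta> b \<bullet> \<alpha> \<Delta> a) \<le> 0"
    using edges by (simp add: inner_commute)
  then show False using alpha_sum_positive[OF D, of S] kS by auto
qed

text \<open>Distinct predecessors of \<open>i\<close> have disjoint sets of ancestors, and the rank
  \<open>f\<close> keeps \<open>i\<close> out of all of them, so no term is counted twice.\<close>

lemma sum_ancestors:
  fixes A :: "'i \<Rightarrow> 'i \<Rightarrow> bool" and f :: "'i \<Rightarrow> nat" and v :: "'i \<Rightarrow> 'b::comm_monoid_add"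
  assumes A: "\<And>i j. adj i j \<longleftrightarrow> A i j \<or> A j i" and f: "\<And>i j. A i j \<Longrightarrow> f i < f j"
  shows "(\<Sum>k | A\<^sup>*\<^sup>* k i. v k) = v i + (\<Sum>j | A j i. \<Sum>k | A\<^sup>*\<^sup>* k j. v k)"
proof -
  have mono: "f a \<le> f b" if "A\<^sup>*\<^sup>* a b" for a b
    using that by induction (auto dest: f)
  have "{k. A\<^sup>*\<^sup>* k i} = insert i (\<Union>j\<in>{j. A j i}. {k. A\<^sup>*\<^sup>* k j})"
    by (auto elim: rtranclp.cases intro: rtranclp.rtrancl_into_rtrancl)
  moreover have "i \<notin> (\<Union>j\<in>{j. A j i}. {k. A\<^sup>*\<^sup>* k j})"
    using mono f by force
  moreover have "(\<Sum>k\<in>(\<Union>j\<in>{j. A j i}. {k. A\<^sup>*\<^sup>* k j}). v k) = (\<Sum>j | A j i. \<Sum>k | A\<^sup>*\<^sup>* k j. v k)"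
    using common_ancestor_unique[where A = A and f = f, OF A f] finite_index
    by (intro sum.UNION_disjoint) blast+
  ultimately show ?thesis using finite_index by simp
qed

text \<open>A telescoping sum. Peeling off the last factor, the one applied first, keeps every
  coefficient an inner product with the original \<open>v\<close>.\<close>

lemma reflection_product_expand:
  assumes D: "simple_system R \<Delta>"
  shows "reflection_product (map (\<alpha> \<Delta>) xs) v = v - (\<Sum>k<length xs. (v \<bullet> \<alpha> \<Delta> (xs ! k)) *\<^sub>R
    reflection_product (map (\<alpha> \<Delta>) (take k xs)) (\<alpha> \<Delta> (xs ! k)))"
proof (induction xs rule: rev_induct)
  case (snoc x xs)
  have "reflection_product (map (\<alpha> \<Delta>) (xs @ [x])) v = reflection_product (map (\<alpha> \<Delta>) xs) v
      - (v \<bullet> \<alpha> \<Delta> x) *\<^sub>R reflection_product (map (\<alpha> \<Delta>) xs) (\<alpha> \<Delta> x)"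
    by (simp add: root_reflection_root[OF alpha_in_R[OF D]]
        linear_diff[OF linear_reflection_product] linear_scale[OF linear_reflection_product])
  then show ?case by (simp add: snoc.IH nth_append)
qed simp

end

section \<open>Compatible simple systems and their heights\<close>

locale coxeter_heights = indexed_root_system R \<alpha>
  for R :: "'a::euclidean_space set" and \<alpha> :: "'a set \<Rightarrow> 'i \<Rightarrow> 'a" +
  fixes C :: "'a \<Rightarrow> 'a" and p :: "'i \<Rightarrow> bit" and i0 :: 'i and \<Phi>0 \<Phi> :: "'a \<Rightarrow> 'i \<times> int"
  assumes coxeter: "coxeter_element R C"
    and Phi: "is_Phi R \<alpha> C p i0 \<Phi>0 \<Phi>"
begin

abbreviation "h \<equiv> coxeter_number C"
abbreviation "arr \<equiv> arrow R \<alpha> C"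
abbreviation "\<beta> \<equiv> beta R \<alpha> C"
abbreviation "ht \<equiv> height_of R \<alpha> C \<Phi>"

lemma ex_compatible: "\<exists>\<Delta>. compatible R \<alpha> C \<Delta>"
proof -
  from coxeter obtain \<Delta> as where D: "simple_system R \<Delta>"
    and as: "distinct as" "set as = \<Delta>" "C = reflection_product as"
    unfolding coxeter_element_def by blast
  let ?g = "inv_into UNIV (\<alpha> \<Delta>)"
  have g: "bij_betw ?g \<Delta> UNIV" by (rule bij_betw_inv_into[OF bij_alpha[OF D]])
  have "map (\<alpha> \<Delta>) (map ?g as) = as"
    unfolding map_map by (rule map_idI) (simp add: f_inv_into_f range_alpha[OF D] as(2))
  moreover have "distinct (map ?g as)" "set (map ?g as) = UNIV"
    using g as by (auto simp: distinct_map bij_betw_def)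
  ultimately have "coxeter_expression \<alpha> C \<Delta> (map ?g as)"
    using as(3) by (simp only: coxeter_expression_def)
  then show ?thesis using D unfolding compatible_def by blast
qed

lemma compatible_simple: "compatible R \<alpha> C \<Delta> \<Longrightarrow> simple_system R \<Delta>"
  by (simp add: compatible_def)

lemma C_in_R:
  assumes "b \<in> R"
  shows "C b \<in> R"
proof -
  from coxeter obtain \<Delta> as where "simple_system R \<Delta>" "set as = \<Delta>" "C = reflection_product as"
    unfolding coxeter_element_def by blast
  then show ?thesis using reflection_product_in_R[OF _ assms] by (simp add: simple_system_def)
qed

text \<open>If C fixed the root of its first letter, the remaining factors would negate that root.
  As they move vectors only within the span of the other simple roots, this contradicts
  independence.\<close>

lemma C_moves_root: "\<exists>b\<in>R. C b \<noteq> b"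
proof -
  obtain \<Delta> js where D: "simple_system R \<Delta>" and js: "coxeter_expression \<alpha> C \<Delta> js"
    using ex_compatible unfolding compatible_def by blast
  then have "js \<noteq> []" by (auto simp: coxeter_expression_def)
  then obtain i "is" where "js = i # is" by (meson neq_Nil_conv)
  with js have C: "C = root_reflection (\<alpha> \<Delta> i) \<circ> reflection_product (map (\<alpha> \<Delta>) is)"
    and i: "i \<notin> set is" by (simp_all add: coxeter_expression_def)
  have "C (\<alpha> \<Delta> i) \<noteq> \<alpha> \<Delta> i"
  proof
    assume "C (\<alpha> \<Delta> i) = \<alpha> \<Delta> i"
    then have "reflection_product (map (\<alpha> \<Delta>) is) (\<alpha> \<Delta> i) = - \<alpha> \<Delta> i"
      unfolding C by (metis comp_apply root_reflection_involution root_reflection_self)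
    then have "2 *\<^sub>R \<alpha> \<Delta> i \<in> span (\<alpha> \<Delta> ` set is)"
      using reflection_product_diff_in_span[of "\<alpha> \<Delta> i" "map (\<alpha> \<Delta>) is"] by (simp add: scaleR_2)
    then have "\<alpha> \<Delta> i \<in> span (\<alpha> \<Delta> ` set is)" using span_scale[of _ _ "1 / 2"] by fastforce
    moreover have "\<alpha> \<Delta> ` set is \<subseteq> \<Delta> - {\<alpha> \<Delta> i}"
      using i alpha_in[OF D] alpha_eq_iff[OF D] by auto
    ultimately have "\<alpha> \<Delta> i \<in> span (\<Delta> - {\<alpha> \<Delta> i})" by (rule subsetD[OF span_mono, rotated])
    then show False
      using D alpha_in[OF D, of i] by (auto simp: simple_system_def dependent_def)
  qed
  then show ?thesis using alpha_in_R[OF D] by blast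
qed

section \<open>Heights and the orientation they determine\<close>

lemma Phi_bij: "bij_betw \<Phi> R (Ihat p h)"
  using Phi by (simp add: is_Phi_def)

lemma Phi_C: "b \<in> R \<Longrightarrow> \<Phi> (C b) = tau h (\<Phi> b)"
  using Phi ex_compatible by (auto simp: is_Phi_def)

text \<open>Read off from \<Phi> without computing the order of C: for h = 0 there would be no
  vertices to receive the roots, and for h = 1 the translation by 2 is trivial, so C would fix every
  root.\<close>

lemma coxeter_number_ge_2: "h \<ge> 2"
proof (rule ccontr)
  assume "\<not> h \<ge> 2"
  then consider "h = 0" | "h = 1" by linarith
  moreover obtain b where b: "b \<in> R" "C b \<noteq> b" using C_moves_root by blast
  then have "\<Phi> b \<in> Ihat p h" using Phi_bij bij_betwE by blast
  then have Z: "snd (\<Phi> b) \<in> Z2h h" by (auto simp: Ihat_def)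
  ultimately show False
  proof cases
    case 1
    then show False using Z by (simp add: Z2h_def)
  next
    case 2
    then have "snd (\<Phi> b) = 0 \<or> snd (\<Phi> b) = 1" using Z by (auto simp: Z2h_def)
    then have "\<Phi> (C b) = \<Phi> b"
      using Phi_C[OF b(1)] 2 by (cases "\<Phi> b") (auto simp: tau_def)
    then show False
      using Phi_bij b C_in_R[OF b(1)] by (auto simp: bij_betw_def inj_on_def)
  qed
qed

lemma Phi_beta: "compatible R \<alpha> C \<Delta> \<Longrightarrow> \<Phi> (\<beta> \<Delta> i) = (i, ht \<Delta> i)"
  using Phi unfolding is_Phi_def height_of_def by (metis mem_Times_iff prod.collapse singletonD)

lemma ht_range: "compatible R \<alpha> C \<Delta> \<Longrightarrow> ht \<Delta> i \<in> Z2h h"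
  using Phi unfolding is_Phi_def height_of_def by (metis mem_Times_iff)

lemma ht_mod: "compatible R \<alpha> C \<Delta> \<Longrightarrow> ht \<Delta> i mod (2 * int h) = ht \<Delta> i"
  using ht_range[of \<Delta> i] by (simp add: Z2h_def)

lemma arrow_ht: "compatible R \<alpha> C \<Delta> \<Longrightarrow> arr \<Delta> i j \<Longrightarrow> ht \<Delta> j = (ht \<Delta> i + 1) mod (2 * int h)"
  using Phi Phi_beta unfolding is_Phi_def by (metis Pair_inject)

lemma succ_mod_asym:
  assumes "x = (y + 1) mod (2 * int h)" and "y = (x + 1) mod (2 * int h)"
  shows False
proof -
  have "y = (y + 2) mod (2 * int h)"
    using assms by (metis add.assoc mod_add_left_eq one_add_one)
  then have "(y + 2) mod (2 * int h) = y mod (2 * int h)" by (metis mod_mod_trivial)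
  then have "2 * int h dvd 2" by (simp add: mod_eq_dvd_iff)
  then show False using coxeter_number_ge_2 by (auto dest!: zdvd_imp_le)
qed

text \<open>The definition of \<open>arrow\<close> allows each arrow its own word for C. That two
  words never order an adjacent pair differently is seen from the heights, which cannot rise by 1 in
  both directions.\<close>

lemma arrow_asym: "compatible R \<alpha> C \<Delta> \<Longrightarrow> arr \<Delta> i j \<Longrightarrow> \<not> arr \<Delta> j i"
  using arrow_ht succ_mod_asym by blast

lemma arrow_adj: "arr \<Delta> i j \<Longrightarrow> adj i j"
  by (simp add: arrow_def)

lemma arrow_of_split:
  assumes "coxeter_expression \<alpha> C \<Delta> (xs @ i # ys)" and "adj j i" and "j \<in> set xs"
  shows "arr \<Delta> j i"
proof -
  obtain k where "k < length xs" "xs ! k = j" using assms(3) by (auto simp: in_set_conv_nth)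
  then show ?thesis
    unfolding arrow_def using assms(1,2)
    by (intro conjI exI[of _ "xs @ i # ys"] exI[of _ k] exI[of _ "length xs"])
      (auto simp: nth_append)
qed

lemma arrow_of_split':
  assumes "coxeter_expression \<alpha> C \<Delta> (xs @ i # ys)" and "adj i j" and "j \<in> set ys"
  shows "arr \<Delta> i j"
proof -
  obtain us vs where "ys = us @ j # vs" using assms(3) by (meson split_list)
  then show ?thesis using arrow_of_split[of \<Delta> "xs @ i # us" j vs i] assms(1,2) by simp
qed

lemma expression_cases:
  assumes "coxeter_expression \<alpha> C \<Delta> (xs @ i # ys)"
  shows "j \<in> set xs \<or> j = i \<or> j \<in> set ys"
proof -
  have "set (xs @ i # ys) = UNIV" using assms by (simp only: coxeter_expression_def)
  then have "j \<in> set (xs @ i # ys)" by simp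
  then show ?thesis by auto
qed

lemma ex_split:
  assumes "coxeter_expression \<alpha> C \<Delta> js"
  shows "\<exists>xs ys. js = xs @ i # ys"
  using assms by (auto simp: coxeter_expression_def intro!: split_list)

lemma adj_iff_arrow:
  assumes "compatible R \<alpha> C \<Delta>"
  shows "adj i j \<longleftrightarrow> arr \<Delta> i j \<or> arr \<Delta> j i"
proof
  assume a: "adj i j"
  obtain js where js: "coxeter_expression \<alpha> C \<Delta> js" using assms by (auto simp: compatible_def)
  obtain xs ys where "js = xs @ i # ys" using ex_split[OF js] by blast
  then show "arr \<Delta> i j \<or> arr \<Delta> j i"
    using js a adj_sym[OF a] expression_cases[of \<Delta> xs i ys j] arrow_of_split arrow_of_split' by auto
qed (auto dest: arrow_adj adj_sym)

lemma arrow_iff_split: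
  assumes "compatible R \<alpha> C \<Delta>" and "coxeter_expression \<alpha> C \<Delta> (xs @ i # ys)"
  shows "arr \<Delta> j i \<longleftrightarrow> adj j i \<and> j \<in> set xs"
  using arrow_of_split[OF assms(2)] arrow_of_split'[OF assms(2)] arrow_asym[OF assms(1)]
    expression_cases[OF assms(2), of j] arrow_adj adj_sym adj_irrefl by metis

lemma arrow_iff_ht:
  assumes "compatible R \<alpha> C \<Delta>"
  shows "arr \<Delta> i j \<longleftrightarrow> adj i j \<and> ht \<Delta> j = (ht \<Delta> i + 1) mod (2 * int h)"
  using arrow_ht[OF assms] adj_iff_arrow[OF assms] succ_mod_asym by blast

section \<open>The vectors \<beta> as partial products of a Coxeter word\<close>

lemma beta_recursion:
  assumes c: "compatible R \<alpha> C \<Delta>"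
  shows "\<beta> \<Delta> i = \<alpha> \<Delta> i + (\<Sum>j | arr \<Delta> j i. \<beta> \<Delta> j)"
proof -
  obtain js where js: "coxeter_expression \<alpha> C \<Delta> js" using c by (auto simp: compatible_def)
  then have "\<forall>i. \<exists>k<length js. js ! k = i"
    by (metis UNIV_I coxeter_expression_def in_set_conv_nth)
  then obtain f where f: "\<And>i. f i < length js" "\<And>i. js ! f i = i" by metis
  \<comment> \<open>The position in one fixed word serves as the rank that excludes oriented
    cycles.\<close>
  have "f i < f j" if a: "arr \<Delta> i j" for i j
  proof (rule ccontr)
    assume "\<not> f i < f j"
    moreover have "f i \<noteq> f j" using f(2) arrow_adj[OF a] adj_irrefl by metis
    ultimately have "f j < f i" by simp
    then have "arr \<Delta> j i"
      unfolding arrow_def using js f adj_sym[OF arrow_adj[OF a]] by blast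
    then show False using arrow_asym[OF c a] by simp
  qed
  then show ?thesis
    unfolding beta_def by (rule sum_ancestors[OF adj_iff_arrow[OF c]])
qed

text \<open>In the telescoping expansion every shorter prefix yields some
  \<open>\<beta> \<Delta> j\<close> by induction. Its coefficient
  \<open>\<alpha> \<Delta> i \<bullet> \<alpha> \<Delta> j\<close> is -1 exactly when j is a
  neighbour occurring before \<open>i\<close>, that is, when there is an arrow from j to
  \<open>i\<close>, and 0 otherwise. What remains is the recursion for
  \<open>\<beta> \<Delta> i\<close>.\<close>

lemma reflection_product_eq_beta:
  assumes c: "compatible R \<alpha> C \<Delta>"
  shows "coxeter_expression \<alpha> C \<Delta> (xs @ i # ys) \<Longrightarrow>
    reflection_product (map (\<alpha> \<Delta>) xs) (\<alpha> \<Delta> i) = \<beta> \<Delta> i"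
proof (induction "length xs" arbitrary: xs i ys rule: less_induct)
  case less
  note D = compatible_simple[OF c]
  have dist: "distinct (xs @ i # ys)" using less.prems by (simp add: coxeter_expression_def)
  have IH: "reflection_product (map (\<alpha> \<Delta>) (take k xs)) (\<alpha> \<Delta> (xs ! k)) = \<beta> \<Delta> (xs ! k)"
    if k: "k < length xs" for k
    using less.hyps[of "take k xs" "xs ! k" "drop (Suc k) xs @ i # ys"] less.prems k
      arg_cong[OF id_take_nth_drop[OF k], of "\<lambda>zs. zs @ i # ys"]
    by simp
  have "(\<Sum>k<length xs. (\<alpha> \<Delta> i \<bullet> \<alpha> \<Delta> (xs ! k)) *\<^sub>R
      reflection_product (map (\<alpha> \<Delta>) (take k xs)) (\<alpha> \<Delta> (xs ! k))) =
      (\<Sum>k<length xs. (\<alpha> \<Delta> i \<bullet> \<alpha> \<Delta> (xs ! k)) *\<^sub>R \<beta> \<Delta> (xs ! k))"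
    by (rule sum.cong) (simp_all add: IH)
  also have "\<dots> = (\<Sum>j\<in>set xs. (\<alpha> \<Delta> i \<bullet> \<alpha> \<Delta> j) *\<^sub>R \<beta> \<Delta> j)"
    using dist by (intro sum.reindex_bij_betw bij_betw_nth) auto
  also have "\<dots> = (\<Sum>j | j \<in> set xs \<and> adj j i. - \<beta> \<Delta> j)"
  proof -
    have "(\<alpha> \<Delta> i \<bullet> \<alpha> \<Delta> j) *\<^sub>R \<beta> \<Delta> j = (if adj j i then - \<beta> \<Delta> j else 0)" if "j \<in> set xs" for j
      using that dist adj_sym[of i j] adj_sym[of j i] by (auto simp: inner_alpha[OF D])
    then show ?thesis by (simp add: sum.inter_filter)
  qed
  also have "{j. j \<in> set xs \<and> adj j i} = {j. arr \<Delta> j i}"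
    using arrow_iff_split[OF c less.prems] by auto
  finally show ?case
    by (simp add: reflection_product_expand[OF D, of xs] beta_recursion[OF c, of i] sum_negf)
qed

lemma beta_in_R:
  assumes c: "compatible R \<alpha> C \<Delta>"
  shows "\<beta> \<Delta> i \<in> R"
proof -
  obtain js where js: "coxeter_expression \<alpha> C \<Delta> js" using c by (auto simp: compatible_def)
  obtain xs ys where "js = xs @ i # ys" using ex_split[OF js] by blast
  then show ?thesis
    using reflection_product_eq_beta[OF c] js alpha_in_R[OF compatible_simple[OF c]]
      reflection_product_in_R[of "map (\<alpha> \<Delta>) xs" "\<alpha> \<Delta> i"] by force
qed

section \<open>From compatible systems to height functions and back\<close>

lemma compatible_height_function:
  assumes c: "compatible R \<alpha> C \<Delta>"
  shows "height_function R \<alpha> p h (ht \<Delta>)"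
proof -
  have "ht \<Delta> j = (ht \<Delta> i + 1) mod (2 * int h) \<or> ht \<Delta> j = (ht \<Delta> i - 1) mod (2 * int h)"
    if "adj i j" for i j
  proof (cases "arr \<Delta> i j")
    case False
    then have "ht \<Delta> i = (ht \<Delta> j + 1) mod (2 * int h)"
      using that adj_iff_arrow[OF c] arrow_ht[OF c] by blast
    then have "(ht \<Delta> i - 1) mod (2 * int h) = ht \<Delta> j mod (2 * int h)"
      by (simp add: mod_diff_left_eq)
    then show ?thesis by (simp add: ht_mod[OF c])
  qed (simp add: arrow_ht[OF c])
  moreover have "of_int (ht \<Delta> i) = p i" for i
  proof -
    have "(i, ht \<Delta> i) \<in> Ihat p h"
      using Phi_bij beta_in_R[OF c, of i] Phi_beta[OF c, of i] bij_betwE by metis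
    then have "p i + of_int (ht \<Delta> i) = 0" by (simp add: Ihat_def)
    then show ?thesis by (cases "p i"; cases "of_int (ht \<Delta> i) :: bit") simp_all
  qed
  ultimately show ?thesis using ht_range[OF c] by (simp add: height_function_def)
qed

lemma ht_inj:
  assumes c: "compatible R \<alpha> C \<Delta>" and c': "compatible R \<alpha> C \<Delta>'" and eq: "ht \<Delta> = ht \<Delta>'"
  shows "\<Delta> = \<Delta>'"
proof -
  have "\<Phi> (\<beta> \<Delta> i) = \<Phi> (\<beta> \<Delta>' i)" for i using Phi_beta c c' eq by simp
  then have b: "\<beta> \<Delta> i = \<beta> \<Delta>' i" for i
    using Phi_bij beta_in_R[OF c] beta_in_R[OF c'] by (auto simp: bij_betw_def inj_on_def)
  have "arr \<Delta> i j \<longleftrightarrow> arr \<Delta>' i j" for i j using arrow_iff_ht[OF c] arrow_iff_ht[OF c'] eq by simp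
  then have "\<alpha> \<Delta> i = \<alpha> \<Delta>' i" for i
    using beta_recursion[OF c, of i] beta_recursion[OF c', of i] by (simp add: b)
  then show ?thesis
    using range_alpha[OF compatible_simple[OF c]] range_alpha[OF compatible_simple[OF c']] by (metis ext)
qed

text \<open>Reflecting in a source \<open>i\<close> moves \<open>s\<^sub>i\<close> from the front of the Coxeter word to its end. All the
  \<open>\<beta>\<^sub>j\<close> with \<open>j \<noteq> i\<close> stay, while \<open>\<beta>\<^sub>i = \<alpha>\<^sub>i\<close> is replaced by \<open>C \<beta>\<^sub>i\<close>.\<close>

lemma raise_source:
  assumes c: "compatible R \<alpha> C \<Delta>" and source: "\<And>j. \<not> arr \<Delta> j i"
  shows "\<exists>\<Delta>'. compatible R \<alpha> C \<Delta>' \<and> ht \<Delta>' = (ht \<Delta>)(i := (ht \<Delta> i + 2) mod (2 * int h))"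
proof -
  note D = compatible_simple[OF c]
  let ?a = "\<alpha> \<Delta>" and ?s = "root_reflection (\<alpha> \<Delta> i)"
  let ?D' = "?s ` \<Delta>"
  obtain js where js: "coxeter_expression \<alpha> C \<Delta> js" using c by (auto simp: compatible_def)
  obtain xs ys where eq: "js = xs @ i # ys" using ex_split[OF js] by blast
  let ?zs = "xs @ ys"
  have dist: "distinct (i # ?zs)" and set: "set (i # ?zs) = UNIV"
    using js by (auto simp: coxeter_expression_def eq)
  \<comment> \<open>A letter before \<open>i\<close> that is adjacent to \<open>i\<close> would give
    an arrow into the source.\<close>
  have "\<forall>b\<in>set (map ?a xs). b \<bullet> ?a i = 0"
    using source arrow_of_split[of \<Delta> xs i ys] js dist by (auto simp: inner_alpha[OF D] eq)
  then have comm: "reflection_product (map ?a xs) (?s x) = ?s (reflection_product (map ?a xs) x)" for x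
    by (rule reflection_product_orthogonal_commute)
  have C: "C = ?s \<circ> reflection_product (map ?a ?zs)"
    using js by (auto simp: coxeter_expression_def eq comm)
  then have at_front: "coxeter_expression \<alpha> C \<Delta> (i # ?zs)"
    using dist set by (simp add: coxeter_expression_def)
  have D': "simple_system R ?D'" by (rule simple_system_root_reflection[OF alpha_in_R[OF D] D])
  have a': "\<alpha> ?D' j = ?s (?a j)" for j by (rule alpha_root_reflection[OF D alpha_in_R[OF D]])
  have conj: "reflection_product (map (\<alpha> ?D') us) (?s x) = ?s (reflection_product (map ?a us) x)" for us x
  proof -
    have "map (\<alpha> ?D') us = map ?s (map ?a us)" by (simp add: a')
    then show ?thesis
      by (simp only: reflection_product_conj[OF linear_root_reflection inner_root_reflection])
  qed
  \<comment> \<open>With P the old product over \<open>?zs\<close>, the new one is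
    (\<open>?s\<close> P \<open>?s\<close>) \<open>?s\<close> = \<open>?s\<close> P: the letters of
    \<open>?zs\<close> are conjugated by \<open>?s\<close>, and the new root with index
    \<open>i\<close> is \<open>- ?a i\<close>, which has the same reflection.\<close>
  have "C x = reflection_product (map (\<alpha> ?D') (?zs @ [i])) x" for x
    using conj[of ?zs x] unfolding C by (simp add: a')
  then have at_end: "coxeter_expression \<alpha> C ?D' (?zs @ [i])"
    using dist set by (auto simp: coxeter_expression_def)
  then have c': "compatible R \<alpha> C ?D'" using D' by (auto simp: compatible_def)
  \<comment> \<open>The old prefix \<open>i # us\<close> starts with the factor \<open>?s\<close>.
    The new prefix lacks \<open>i\<close>, but conjugating both prefix and root by \<open>?s\<close>
    restores that factor.\<close>
  have "\<beta> ?D' j = \<beta> \<Delta> j" if "j \<noteq> i" for j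
  proof -
    have "j \<in> set ?zs" using set that by auto
    then obtain us vs where zs: "?zs = us @ j # vs" by (meson split_list)
    have "\<beta> ?D' j = reflection_product (map (\<alpha> ?D') us) (\<alpha> ?D' j)"
      using reflection_product_eq_beta[OF c', of us j "vs @ [i]"] at_end unfolding zs by simp
    also have "\<dots> = ?s (reflection_product (map ?a us) (?a j))" by (simp add: a' conj)
    also have "\<dots> = \<beta> \<Delta> j"
      using reflection_product_eq_beta[OF c, of "i # us" j vs] at_front unfolding zs by simp
    finally show ?thesis .
  qed
  moreover have "\<beta> ?D' i = C (\<beta> \<Delta> i)"
  proof -
    have "\<beta> \<Delta> i = ?a i" using reflection_product_eq_beta[OF c, of "[]" i ?zs] at_front by simp
    moreover have "\<beta> ?D' i = reflection_product (map (\<alpha> ?D') ?zs) (\<alpha> ?D' i)"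
      using reflection_product_eq_beta[OF c', of ?zs i "[]"] at_end by simp
    moreover have "\<dots> = ?s (reflection_product (map ?a ?zs) (?a i))"
      unfolding a'[of i] by (rule conj)
    ultimately show ?thesis unfolding C by simp
  qed
  ultimately have "ht ?D' j = ((ht \<Delta>)(i := (ht \<Delta> i + 2) mod (2 * int h))) j" for j
    using Phi_C[OF beta_in_R[OF c]] Phi_beta[OF c, of i] by (simp add: height_of_def tau_def split_beta)
  then show ?thesis using c' by blast
qed

lemma ex_lift:
  assumes "height_function R \<alpha> p h \<eta>"
  shows "\<exists>f. (\<forall>i. f i mod (2 * int h) = \<eta> i) \<and> (\<forall>i j. adj i j \<longrightarrow> f j = f i + 1 \<or> f j = f i - 1)"
  using assms by (intro height_lift) (auto simp: height_function_def Z2h_def)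

text \<open>Induction on the total gap between the lift \<open>f\<close> of the current heights and
  the target \<open>g\<close>. The target stays fixed, while system and lift move together.\<close>

lemma raise_to:
  fixes f g :: "'i \<Rightarrow> int"
  assumes "compatible R \<alpha> C \<Delta>" and "\<And>i. f i mod (2 * int h) = ht \<Delta> i"
    and "\<And>i j. adj i j \<Longrightarrow> f j = f i + 1 \<or> f j = f i - 1"
    and g: "\<And>i j. adj i j \<Longrightarrow> g j = g i + 1 \<or> g j = g i - 1"
    and "\<And>i. f i \<le> g i" and "\<And>i. even (g i - f i)"
  shows "\<exists>\<Delta>'. compatible R \<alpha> C \<Delta>' \<and> (\<forall>i. ht \<Delta>' i = g i mod (2 * int h))"
  using assms(1-3,5,6)
proof (induction "nat (\<Sum>i\<in>UNIV. g i - f i)" arbitrary: \<Delta> f rule: less_induct)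
  case less
  show ?case
  proof (cases "f = g")
    case True
    then show ?thesis using less.prems(1,2) by metis
  next
    case False
    then obtain i where i: "f i < g i" "\<And>j. adj i j \<Longrightarrow> f j = f i + 1"
      using ex_raisable_source[of f g] less.prems(3,4) g by blast
    \<comment> \<open>All neighbours of \<open>i\<close> are one step higher, so an arrow into
      \<open>i\<close> would make the heights rise in both directions.\<close>
    have "\<not> arr \<Delta> j i" for j
    proof
      assume a: "arr \<Delta> j i"
      have "ht \<Delta> j = (ht \<Delta> i + 1) mod (2 * int h)"
        using i(2)[OF adj_sym[OF arrow_adj[OF a]]]
        by (metis less.prems(2) mod_add_left_eq)
      then show False using arrow_ht[OF less.prems(1) a] succ_mod_asym by blast
    qed
    then obtain \<Delta>' where c': "compatible R \<alpha> C \<Delta>'"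
      and h': "ht \<Delta>' = (ht \<Delta>)(i := (ht \<Delta> i + 2) mod (2 * int h))"
      using raise_source[OF less.prems(1)] by blast
    let ?f = "f(i := f i + 2)"
    \<comment> \<open>Parity turns the strict inequality into a gap of at least 2, so the move does
      not overshoot \<open>g\<close>.\<close>
    have gap: "g i - f i \<ge> 2" using i(1) less.prems(5)[of i] by presburger
    have "?f k mod (2 * int h) = ht \<Delta>' k" for k
      by (simp add: h' mod_add_left_eq flip: less.prems(2))
    moreover have "?f k = ?f l + 1 \<or> ?f k = ?f l - 1" if lk: "adj l k" for k l
    proof -
      consider "k = i" "l \<noteq> i" | "l = i" "k \<noteq> i" | "k \<noteq> i" "l \<noteq> i"
        using lk by (cases "k = i"; cases "l = i") auto
      then show ?thesis
      proof cases
        case 1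
        then show ?thesis using i(2)[of l] adj_sym[OF lk] by simp
      next
        case 2
        then show ?thesis using i(2)[of k] lk by simp
      next
        case 3
        then show ?thesis using less.prems(3)[OF lk] by simp
      qed
    qed
    moreover have "?f k \<le> g k" and "even (g k - ?f k)" for k
      using gap less.prems(4,5)[of k] by auto
    moreover have "nat (\<Sum>k\<in>UNIV. g k - ?f k) < nat (\<Sum>k\<in>UNIV. g k - f k)"
    proof -
      have lt: "(\<Sum>k\<in>UNIV. g k - ?f k) < (\<Sum>k\<in>UNIV. g k - f k)"
        by (rule sum_strict_mono_ex1[OF finite_index]) auto
      moreover have "(\<Sum>k\<in>UNIV. g k - ?f k) \<ge> 0"
        using \<open>\<And>k. ?f k \<le> g k\<close> by (intro sum_nonneg) (simp only: diff_ge_0_iff_ge)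
      ultimately show ?thesis by linarith
    qed
    ultimately show ?thesis using less.hyps[of ?f \<Delta>'] c' by blast
  qed
qed

lemma ex_compatible_height:
  assumes eta: "height_function R \<alpha> p h \<eta>"
  shows "\<exists>\<Delta>. compatible R \<alpha> C \<Delta> \<and> ht \<Delta> = \<eta>"
proof -
  obtain \<Delta> where c: "compatible R \<alpha> C \<Delta>" using ex_compatible ..
  obtain f where f: "\<And>i. f i mod (2 * int h) = ht \<Delta> i"
    "\<And>i j. adj i j \<Longrightarrow> f j = f i + 1 \<or> f j = f i - 1"
    using ex_lift[OF compatible_height_function[OF c]] by blast
  obtain g where g: "\<And>i. g i mod (2 * int h) = \<eta> i"
    "\<And>i j. adj i j \<Longrightarrow> g j = g i + 1 \<or> g j = g i - 1"
    using ex_lift[OF eta] by blast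
  \<comment> \<open>The modulus is even, so parity survives reduction. Both height functions have
    parity \<open>p\<close>; hence their lifts differ by even numbers, as moves by 2
    require.\<close>
  have par: "even (x - y)" if "of_int (x mod (2 * int h)) = (of_int (y mod (2 * int h)) :: bit)" for x y
  proof -
    have "even (x mod (2 * int h)) \<longleftrightarrow> even (y mod (2 * int h))"
      using that by (metis even_of_int_iff)
    then show ?thesis by (simp add: dvd_mod_iff)
  qed
  have even: "even (g i - f i)" for i
    using f(1)[of i] g(1)[of i] eta compatible_height_function[OF c]
    by (intro par) (simp add: height_function_def)
  define N where "N = (\<Sum>i\<in>UNIV. \<bar>f i - g i\<bar>)"
  have N: "f i - g i \<le> N" for i
    using member_le_sum[of i UNIV "\<lambda>i. \<bar>f i - g i\<bar>"] finite_index by (auto simp: N_def)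
  \<comment> \<open>The shift is a multiple of \<open>2 * h\<close>, so residues and differences
    along edges are unchanged; being at least \<open>N\<close>, it puts the target above
    \<open>f\<close> everywhere.\<close>
  define g' where "g' = (\<lambda>i. g i + 2 * int h * N)"
  have "N \<ge> 0" by (simp add: N_def sum_nonneg)
  moreover have "1 \<le> 2 * int h" using coxeter_number_ge_2 by simp
  ultimately have "1 * N \<le> 2 * int h * N" by (rule mult_right_mono[rotated])
  then have "f i \<le> g' i" for i using N[of i] by (simp add: g'_def)
  moreover have "even (g' i - f i)" for i using even[of i] by (simp add: g'_def)
  moreover have "g' j = g' i + 1 \<or> g' j = g' i - 1" if "adj i j" for i j
    using g(2)[OF that] by (auto simp: g'_def)
  ultimately obtain \<Delta>' where "compatible R \<alpha> C \<Delta>'" "\<forall>i. ht \<Delta>' i = g' i mod (2 * int h)"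
    using raise_to[OF c f(1) f(2), of g'] by blast
  moreover have "g' i mod (2 * int h) = \<eta> i" for i using g(1) by (simp add: g'_def)
  ultimately show ?thesis by auto
qed

end

theorem theorem5p9:
  fixes R :: "'a::euclidean_space set"
    and \<alpha> :: "'a set \<Rightarrow> 'i \<Rightarrow> 'a"
    and C :: "'a \<Rightarrow> 'a"
    and p :: "'i \<Rightarrow> bit"
    and i0 :: 'i
    and \<Phi>0 \<Phi> :: "'a \<Rightarrow> 'i \<times> int"
  assumes "root_system R" and "reduced_system R" and "irreducible_system R"
    and "simply_laced_normalized R"
    and "simple_root_indexing R \<alpha>"
    and "coxeter_element R C"
    and "parity_function R \<alpha> p"
    and "is_Phi0 R \<alpha> C p i0 \<Phi>0"
    and "is_Phi R \<alpha> C p i0 \<Phi>0 \<Phi>"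
  shows "(\<forall>\<Delta>. compatible R \<alpha> C \<Delta> \<longrightarrow>
            (\<forall>i. \<Phi> (beta R \<alpha> C \<Delta> i) = (i, height_of R \<alpha> C \<Phi> \<Delta> i)) \<and>
            height_function R \<alpha> p (coxeter_number C) (height_of R \<alpha> C \<Phi> \<Delta>)) \<and>
         (\<forall>\<eta>. height_function R \<alpha> p (coxeter_number C) \<eta> \<longrightarrow>
            (\<exists>!\<Delta>. compatible R \<alpha> C \<Delta> \<and> height_of R \<alpha> C \<Phi> \<Delta> = \<eta>))"
proof -
  interpret coxeter_heights R \<alpha> C p i0 \<Phi>0 \<Phi>
    using assms by unfold_locales (auto simp: coxeter_element_def)
  show ?thesis
    using Phi_beta compatible_height_function ex_compatible_height ht_inj by blast
qed

end
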